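(* Let $X$ be a Banach space, $(\Omega,\mathcal{A},P)$ a probability space, and let $(B_t)_{t\ge0}$ be a weak set-valued Gaussian process with homogeneous increments, such that $B_0=0$. If $(B_t^2-te)_t$ is a pointwise martingale, then $(B_t)_t$ is a (weak) Wiener process. Consequently, if moreover the trajectories of $(B_t)_t$ are weakly continuous, then $(B_t)_t$ is a set-valued Brownian motion.
   Context: For a Banach space $X$, $ck(X)$ is the family of nonempty compact convex subsets of $X$, with Minkowski addition, multiplication by scalars and the Hausdorff metric $d_H$. $K$ is a compact Hausdorff space and $j:ck(X)\to C(K)$ is a map (such $K,j$ exist) satisfying: (a) $j(\alpha A+\beta C)=\alpha j(A)+\beta j(C)$ for all $A,C\in ck(X)$, $\alpha,\beta\ge 0$; (b) $d_H(A,C)=\|j(A)-j(C)\|_\infty$; (c) $j(ck(X))$ is norm closed; (d) $j(\mathrm{co}(A\cup C))=\max\{j(A),j(C)\}$. Sums, differences and products are taken in $C(K)$ via $j$. $e$ is the unit function (constant $1$) of $C(K)$. $ck_r(X)$ denotes the collection of functions $r1_B$ with $r\in\mathbb{R}$, $B\in ck(X)$; $r1_B$ is identified with $r\,j(B)\in C(K)$. Set-valued processes here are processes of (strongly measurable) maps $\Omega\to ck_r(X)\subset C(K)$. An evaluation functional is an $f\in C(K)^*$ of the form $f(x)=x(k)$ for some fixed $k\in K$. $(B_t)_t$ is a weak set-valued Gaussian process if for every evaluation functional $f$ the real process $(f(B_t))_t$ is Gaussian; it has homogeneous increments if for every evaluation functional $f$ and $0\le s<t$ the variable $f(B_t-B_s)$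 has the same distribution as $f(B_{t-s})$. It is a (weak) Wiener process if for every evaluation functional $f$ the process $(f(B_t))_t$ is a Gaussian process with zero mean, $f(B_0)=0$ and $\mathbb{E}(f(B_tB_s))=\min(s,t)$ for all $s,t\ge 0$. For a Bochner integrable $W$ and a sub-$\sigma$-algebra $\mathcal{F}\subset\mathcal{A}$, $\mathbb{E}(W\mid\mathcal{F})$ is the Bochner integrable function with respect to $(\Omega,\mathcal{F},P)$ such that $\mathbb{E}(f(W)\mid\mathcal{F})=f(\mathbb{E}(W\mid\mathcal{F}))$ for every $f\in C(K)^*$. A process $(M_t)_t$ is a pointwise martingale if each $M_t$ is Bochner integrable and $\mathbb{E}(M_t\mid\mathcal{F}_s)=M_s$ for all $s<t$, where $(\mathcal{F}_s)_s$ is the natural filtration of $(M_t)_t$. A process $(B_t)_t$ with values in $ck_r(X)\subset C(K)$ is a set-valued Brownian motion if: (1) there is an $f$-algebra $L$ such that $B_t(\omega)\in L$ for each $\omega\in\Omega$ and $t>0$; (2) $B_t$ and $B_t^2$ are $C(K)$-valued Bochner integrable functions for each $t>0$; (3) for every evaluation functional $f\in C(K)^*$ the process $(f(B_t))_t$ is a standard real Brownian motion. *)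

theory Defs
  imports "HOL-Probability.Probability"
begin

section \<open>The algebra and lattice structure of C(K)\<close>

text \<open>For compact K every continuous function is bounded, so C(K) is the Banach space
  of bounded continuous functions \<open>'k \<Rightarrow>\<^sub>C real\<close> with the supremum norm. The library
  provides no product and no order on this type.\<close>

definition mult_bcontfun ::
  "('k::topological_space \<Rightarrow>\<^sub>C real) \<Rightarrow> ('k \<Rightarrow>\<^sub>C real) \<Rightarrow> ('k \<Rightarrow>\<^sub>C real)" where
  "mult_bcontfun x y = Bcontfun (\<lambda>k. x k * y k)"

definition inf_bcontfun ::
  "('k::topological_space \<Rightarrow>\<^sub>C real) \<Rightarrow> ('k \<Rightarrow>\<^sub>C real) \<Rightarrow> ('k \<Rightarrow>\<^sub>C real)" where
  "inf_bcontfun x y = Bcontfun (\<lambda>k. min (x k) (y k))"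

definition sup_bcontfun ::
  "('k::topological_space \<Rightarrow>\<^sub>C real) \<Rightarrow> ('k \<Rightarrow>\<^sub>C real) \<Rightarrow> ('k \<Rightarrow>\<^sub>C real)" where
  "sup_bcontfun x y = Bcontfun (\<lambda>k. max (x k) (y k))"

lemma bcontfun_binop:
  fixes x y :: "'k::topological_space \<Rightarrow>\<^sub>C real"
  shows mult_bcontfun_apply: "mult_bcontfun x y k = x k * y k"
    and inf_bcontfun_apply: "inf_bcontfun x y k = min (x k) (y k)"
    and sup_bcontfun_apply: "sup_bcontfun x y k = max (x k) (y k)"
proof -
  obtain a b where a: "\<And>k. \<bar>x k\<bar> \<le> a" and b: "\<And>k. \<bar>y k\<bar> \<le> b"
    using bounded_apply_bcontfun[of x] bounded_apply_bcontfun[of y]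
    by (auto simp: bounded_iff)
  have "a \<ge> 0" using a[of k] by linarith
  then have 1: "\<bar>x k * y k\<bar> \<le> a * b" for k
    using a[of k] b[of k] by (auto simp: abs_mult intro!: mult_mono)
  have 2: "\<bar>min (x k) (y k)\<bar> \<le> max a b" and 3: "\<bar>max (x k) (y k)\<bar> \<le> max a b" for k
    using a[of k] b[of k] by auto
  have "(\<lambda>k. x k * y k) \<in> bcontfun" "(\<lambda>k. min (x k) (y k)) \<in> bcontfun"
    "(\<lambda>k. max (x k) (y k)) \<in> bcontfun"
    using 1 2 3 by (auto simp: bcontfun_def bounded_iff intro!: continuous_intros)
  then show "mult_bcontfun x y k = x k * y k" "inf_bcontfun x y k = min (x k) (y k)"
    "sup_bcontfun x y k = max (x k) (y k)"
    by (simp_all add: mult_bcontfun_def inf_bcontfun_def sup_bcontfun_def Bcontfun_inverse)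
qed

definition le_bcontfun ::
  "('k::topological_space \<Rightarrow>\<^sub>C real) \<Rightarrow> ('k \<Rightarrow>\<^sub>C real) \<Rightarrow> bool" where
  "le_bcontfun x y \<longleftrightarrow> (\<forall>k. x k \<le> y k)"

abbreviation unit_bcontfun :: "'k::topological_space \<Rightarrow>\<^sub>C real" where
  "unit_bcontfun \<equiv> const_bcontfun 1"

definition riesz_space ::
  "'a::real_vector set \<Rightarrow> ('a \<Rightarrow> 'a \<Rightarrow> bool) \<Rightarrow> ('a \<Rightarrow> 'a \<Rightarrow> 'a) \<Rightarrow> ('a \<Rightarrow> 'a \<Rightarrow> 'a) \<Rightarrow> bool" where
  "riesz_space L le wedge vee \<longleftrightarrow>
     subspace L \<and>
     (\<forall>x\<in>L. le x x) \<and>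
     (\<forall>x\<in>L. \<forall>y\<in>L. le x y \<and> le y x \<longrightarrow> x = y) \<and>
     (\<forall>x\<in>L. \<forall>y\<in>L. \<forall>z\<in>L. le x y \<and> le y z \<longrightarrow> le x z) \<and>
     (\<forall>x\<in>L. \<forall>y\<in>L. \<forall>z\<in>L. le x y \<longrightarrow> le (x + z) (y + z)) \<and>
     (\<forall>x\<in>L. \<forall>y\<in>L. \<forall>r\<ge>0. le x y \<longrightarrow> le (r *\<^sub>R x) (r *\<^sub>R y)) \<and>
     (\<forall>x\<in>L. \<forall>y\<in>L. wedge x y \<in> L \<and> le (wedge x y) x \<and> le (wedge x y) y \<and>
        (\<forall>z\<in>L. le z x \<and> le z y \<longrightarrow> le z (wedge x y))) \<and>
     (\<forall>x\<in>L. \<forall>y\<in>L. vee x y \<in> L \<and> le x (vee x y) \<and> le y (vee x y) \<and>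
        (\<forall>z\<in>L. le x z \<and> le y z \<longrightarrow> le (vee x y) z))"

definition f_algebra ::
  "'a::real_vector set \<Rightarrow> ('a \<Rightarrow> 'a \<Rightarrow> bool) \<Rightarrow> ('a \<Rightarrow> 'a \<Rightarrow> 'a) \<Rightarrow> ('a \<Rightarrow> 'a \<Rightarrow> 'a) \<Rightarrow>
   ('a \<Rightarrow> 'a \<Rightarrow> 'a) \<Rightarrow> bool" where
  "f_algebra L le wedge vee mul \<longleftrightarrow>
     riesz_space L le wedge vee \<and>
     (\<forall>x\<in>L. \<forall>y\<in>L. mul x y \<in> L) \<and>
     (\<forall>x\<in>L. \<forall>y\<in>L. \<forall>z\<in>L. mul (mul x y) z = mul x (mul y z)) \<and>
     (\<forall>x\<in>L. \<forall>y\<in>L. \<forall>z\<in>L. mul (x + y) z = mul x z + mul y z \<and>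
        mul z (x + y) = mul z x + mul z y) \<and>
     (\<forall>x\<in>L. \<forall>y\<in>L. \<forall>r. mul (r *\<^sub>R x) y = r *\<^sub>R mul x y \<and>
        mul x (r *\<^sub>R y) = r *\<^sub>R mul x y) \<and>
     (\<forall>x\<in>L. \<forall>y\<in>L. le 0 x \<and> le 0 y \<longrightarrow> le 0 (mul x y)) \<and>
     (\<forall>x\<in>L. \<forall>y\<in>L. \<forall>z\<in>L. wedge x y = 0 \<and> le 0 z \<longrightarrow>
        wedge (mul x z) y = 0 \<and> wedge (mul z x) y = 0)"

definition evaluation_functional ::
  "(('k::topological_space \<Rightarrow>\<^sub>C real) \<Rightarrow> real) \<Rightarrow> bool" where
  "evaluation_functional f \<longleftrightarrow> (\<exists>k. f = (\<lambda>x. apply_bcontfun x k))"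

section \<open>The hyperspace ck(X) and its embedding\<close>

definition ck :: "'x::real_normed_vector set set" where
  "ck = {A. A \<noteq> {} \<and> compact A \<and> convex A}"

definition minkowski_comb ::
  "real \<Rightarrow> 'x::real_vector set \<Rightarrow> real \<Rightarrow> 'x set \<Rightarrow> 'x set" where
  "minkowski_comb \<alpha> A \<beta> C = {\<alpha> *\<^sub>R a + \<beta> *\<^sub>R c | a c. a \<in> A \<and> c \<in> C}"

definition hausdorff_dist :: "'x::metric_space set \<Rightarrow> 'x set \<Rightarrow> real" where
  "hausdorff_dist A C = max (SUP a\<in>A. infdist a C) (SUP c\<in>C. infdist c A)"

definition ck_embedding ::
  "('x::banach set \<Rightarrow> ('k::topological_space \<Rightarrow>\<^sub>C real)) \<Rightarrow> bool" where
  "ck_embedding j \<longleftrightarrow>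
     (\<forall>A\<in>ck. \<forall>C\<in>ck. \<forall>\<alpha>\<ge>0. \<forall>\<beta>\<ge>0.
        j (minkowski_comb \<alpha> A \<beta> C) = \<alpha> *\<^sub>R j A + \<beta> *\<^sub>R j C) \<and>
     (\<forall>A\<in>ck. \<forall>C\<in>ck. hausdorff_dist A C = norm (j A - j C)) \<and>
     closed (j ` ck) \<and>
     (\<forall>A\<in>ck. \<forall>C\<in>ck. j (convex hull (A \<union> C)) = sup_bcontfun (j A) (j C))"

text \<open>The image in C(K) of the functions \<open>r 1\<^sub>B\<close>.\<close>

definition ck_r ::
  "('x::banach set \<Rightarrow> ('k::topological_space \<Rightarrow>\<^sub>C real)) \<Rightarrow> ('k \<Rightarrow>\<^sub>C real) set" where
  "ck_r j = {r *\<^sub>R j A | r A. A \<in> ck}"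

section \<open>Measurability and integrability in non-separable Banach spaces\<close>

text \<open>The library's Bochner integral is restricted to second countable value spaces, and C(K)
  need not be separable, so the definitions are repeated here without that restriction.
  Limits of simple functions are taken almost everywhere. Borel measurability is automatic
  from this when the measure is complete; in general it ensures that the process
  generates sub-\<open>\<sigma>\<close>-algebras of the given one.\<close>

definition strongly_measurable :: "'w measure \<Rightarrow> ('w \<Rightarrow> 'b::real_normed_vector) \<Rightarrow> bool" where
  "strongly_measurable M f \<longleftrightarrow>
     f \<in> borel_measurable M \<and>
     (\<exists>s. (\<forall>i. simple_function M (s i)) \<and> (AE \<omega> in M. (\<lambda>i. s i \<omega>) \<longlonglongrightarrow> f \<omega>))"

definition bochner_integrable :: "'w measure \<Rightarrow> ('w \<Rightarrow> 'b::real_normed_vector) \<Rightarrow> bool" where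
  "bochner_integrable M f \<longleftrightarrow>
     strongly_measurable M f \<and>
     (\<exists>s. (\<forall>i. Bochner_Integration.simple_bochner_integrable M (s i)) \<and>
        (\<lambda>i. \<integral>\<^sup>+\<omega>. norm (f \<omega> - s i \<omega>) \<partial>M) \<longlonglongrightarrow> 0)"

text \<open>\<open>V\<close> is a version of the conditional expectation of \<open>W\<close> given \<open>F\<close>.\<close>

definition bochner_cond_exp ::
  "'w measure \<Rightarrow> 'w measure \<Rightarrow> ('w \<Rightarrow> 'b::real_normed_vector) \<Rightarrow> ('w \<Rightarrow> 'b) \<Rightarrow> bool" where
  "bochner_cond_exp M F W V \<longleftrightarrow>
     bochner_integrable (restr_to_subalg M F) V \<and>
     (\<forall>f::'b \<Rightarrow> real. bounded_linear f \<longrightarrow>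
        (AE \<omega> in M. real_cond_exp M F (\<lambda>\<omega>'. f (W \<omega>')) \<omega> = f (V \<omega>)))"

text \<open>All processes are indexed by \<open>t \<ge> 0\<close>; values at negative times are irrelevant.\<close>

definition natural_filtration ::
  "'w measure \<Rightarrow> (real \<Rightarrow> 'w \<Rightarrow> 'b::topological_space) \<Rightarrow> real \<Rightarrow> 'w measure" where
  "natural_filtration M Y s =
     sigma (space M) {Y u -` A \<inter> space M | u A. 0 \<le> u \<and> u \<le> s \<and> A \<in> sets borel}"

definition pointwise_martingale ::
  "'w measure \<Rightarrow> (real \<Rightarrow> 'w \<Rightarrow> 'b::real_normed_vector) \<Rightarrow> bool" where
  "pointwise_martingale M Y \<longleftrightarrow>
     (\<forall>t\<ge>0. bochner_integrable M (Y t)) \<and>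
     (\<forall>s t. 0 \<le> s \<and> s < t \<longrightarrow> bochner_cond_exp M (natural_filtration M Y s) (Y t) (Y s))"

section \<open>Real-valued processes\<close>

text \<open>Normal laws with variance zero are admitted, as is needed for processes
  starting at a constant.\<close>

definition gaussian_rv :: "'w measure \<Rightarrow> ('w \<Rightarrow> real) \<Rightarrow> bool" where
  "gaussian_rv M Y \<longleftrightarrow>
     Y \<in> borel_measurable M \<and>
     ((\<exists>\<mu>. AE \<omega> in M. Y \<omega> = \<mu>) \<or>
      (\<exists>\<mu> \<sigma>. \<sigma> > 0 \<and> distributed M lborel Y (normal_density \<mu> \<sigma>)))"

definition gaussian_process :: "'w measure \<Rightarrow> (real \<Rightarrow> 'w \<Rightarrow> real) \<Rightarrow> bool" where
  "gaussian_process M Y \<longleftrightarrow>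
     (\<forall>T c. finite T \<and> T \<subseteq> {0..} \<longrightarrow> gaussian_rv M (\<lambda>\<omega>. \<Sum>t\<in>T. c t * Y t \<omega>))"

definition standard_brownian_motion :: "'w measure \<Rightarrow> (real \<Rightarrow> 'w \<Rightarrow> real) \<Rightarrow> bool" where
  "standard_brownian_motion M Y \<longleftrightarrow>
     (\<forall>t\<ge>0. Y t \<in> borel_measurable M) \<and>
     (AE \<omega> in M. Y 0 \<omega> = 0) \<and>
     (\<forall>(\<tau>::nat \<Rightarrow> real) n. 0 \<le> \<tau> 0 \<and> (\<forall>i<n. \<tau> i < \<tau> (Suc i)) \<longrightarrow>
        prob_space.indep_vars M (\<lambda>_. borel) (\<lambda>i \<omega>. Y (\<tau> (Suc i)) \<omega> - Y (\<tau> i) \<omega>) {..<n}) \<and>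
     (\<forall>s t. 0 \<le> s \<and> s < t \<longrightarrow>
        distributed M lborel (\<lambda>\<omega>. Y t \<omega> - Y s \<omega>) (normal_density 0 (sqrt (t - s)))) \<and>
     (\<forall>\<omega>\<in>space M. continuous_on {0..} (\<lambda>t. Y t \<omega>))"

section \<open>Set-valued processes\<close>

definition set_valued_process ::
  "('x::banach set \<Rightarrow> ('k::topological_space \<Rightarrow>\<^sub>C real)) \<Rightarrow> 'w measure \<Rightarrow>
   (real \<Rightarrow> 'w \<Rightarrow> ('k \<Rightarrow>\<^sub>C real)) \<Rightarrow> bool" where
  "set_valued_process j M B \<longleftrightarrow>
     (\<forall>t\<ge>0. strongly_measurable M (B t) \<and> (\<forall>\<omega>\<in>space M. B t \<omega> \<in> ck_r j))"

definition weak_gaussian_process ::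
  "('x::banach set \<Rightarrow> ('k::topological_space \<Rightarrow>\<^sub>C real)) \<Rightarrow> 'w measure \<Rightarrow>
   (real \<Rightarrow> 'w \<Rightarrow> ('k \<Rightarrow>\<^sub>C real)) \<Rightarrow> bool" where
  "weak_gaussian_process j M B \<longleftrightarrow>
     set_valued_process j M B \<and>
     (\<forall>f. evaluation_functional f \<longrightarrow> gaussian_process M (\<lambda>t \<omega>. f (B t \<omega>)))"

definition homogeneous_increments ::
  "'w measure \<Rightarrow> (real \<Rightarrow> 'w \<Rightarrow> ('k::topological_space \<Rightarrow>\<^sub>C real)) \<Rightarrow> bool" where
  "homogeneous_increments M B \<longleftrightarrow>
     (\<forall>f s t. evaluation_functional f \<and> 0 \<le> s \<and> s < t \<longrightarrow>
        distr M borel (\<lambda>\<omega>. f (B t \<omega> - B s \<omega>)) = distr M borel (\<lambda>\<omega>. f (B (t - s) \<omega>)))"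

definition weak_wiener_process ::
  "('x::banach set \<Rightarrow> ('k::topological_space \<Rightarrow>\<^sub>C real)) \<Rightarrow> 'w measure \<Rightarrow>
   (real \<Rightarrow> 'w \<Rightarrow> ('k \<Rightarrow>\<^sub>C real)) \<Rightarrow> bool" where
  "weak_wiener_process j M B \<longleftrightarrow>
     set_valued_process j M B \<and>
     (\<forall>f. evaluation_functional f \<longrightarrow>
        gaussian_process M (\<lambda>t \<omega>. f (B t \<omega>)) \<and>
        (\<forall>t\<ge>0. (\<integral>\<omega>. f (B t \<omega>) \<partial>M) = 0) \<and>
        (AE \<omega> in M. f (B 0 \<omega>) = 0) \<and>
        (\<forall>s\<ge>0. \<forall>t\<ge>0. integrable M (\<lambda>\<omega>. f (mult_bcontfun (B t \<omega>) (B s \<omega>))) \<and>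
           (\<integral>\<omega>. f (mult_bcontfun (B t \<omega>) (B s \<omega>)) \<partial>M) = min s t))"

definition weakly_continuous_trajectories ::
  "'w measure \<Rightarrow> (real \<Rightarrow> 'w \<Rightarrow> 'b::real_normed_vector) \<Rightarrow> bool" where
  "weakly_continuous_trajectories M B \<longleftrightarrow>
     (\<forall>\<omega>\<in>space M. \<forall>f::'b \<Rightarrow> real. bounded_linear f \<longrightarrow> continuous_on {0..} (\<lambda>t. f (B t \<omega>)))"

text \<open>The f-algebra \<open>L\<close> in the definition of set-valued Brownian motion is a subset of C(K)
  with the pointwise operations and order, since the values and the squares of the process
  are taken in C(K).\<close>

definition set_valued_brownian_motion ::
  "('x::banach set \<Rightarrow> ('k::topological_space \<Rightarrow>\<^sub>C real)) \<Rightarrow> 'w measure \<Rightarrow>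
   (real \<Rightarrow> 'w \<Rightarrow> ('k \<Rightarrow>\<^sub>C real)) \<Rightarrow> bool" where
  "set_valued_brownian_motion j M B \<longleftrightarrow>
     set_valued_process j M B \<and>
     (\<exists>L. f_algebra L le_bcontfun inf_bcontfun sup_bcontfun mult_bcontfun \<and>
        (\<forall>t>0. \<forall>\<omega>\<in>space M. B t \<omega> \<in> L)) \<and>
     (\<forall>t>0. bochner_integrable M (B t) \<and>
        bochner_integrable M (\<lambda>\<omega>. mult_bcontfun (B t \<omega>) (B t \<omega>))) \<and>
     (\<forall>f. evaluation_functional f \<longrightarrow> standard_brownian_motion M (\<lambda>t \<omega>. f (B t \<omega>)))"

end

theory Submission
  imports Defs
begin

text \<open>Fix \<open>k\<close> and put \<open>Y t = B t k\<close>. Taking expectations in the martingale property gives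
  \<open>E (Y t)\<^sup>2 = t\<close>. Homogeneity makes \<open>E (Y t)\<close> additive in \<open>t\<close>; being bounded by \<open>sqrt t\<close>, it
  vanishes. Homogeneity also gives \<open>E (Y t - Y s)\<^sup>2 = t - s\<close>, and polarization yields the covariance
  \<open>min s t\<close>. The increments are therefore uncorrelated, and since all their linear combinations are
  Gaussian their joint characteristic function factors, so they are independent. The Bochner
  integrability of \<open>B t\<close> follows from that of its square because the norm of the square is the
  square of the norm.\<close>

text \<open>Evaluation at a point reduces the claim to a real process, except for the integrability
  of \<open>B t\<close> in the supremum norm: Gaussian coordinates give no bound that is uniform in
  the point, so it is extracted from the integrability that the martingale carries. Without
  separability even the difference of two Borel functions may fail to be Borel; measurability is
  therefore transported along continuous maps or along functions with finitely many values.
  Independence is reached with Levy's theorem on the line alone. The exponentials in the joint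
  characteristic function are exchanged for indicators one variable at a time, the remaining factors
  acting as a density. Such a factor is complex, hence the detour through nonnegative trigonometric
  weights. Gaussian laws may have variance zero, and already the combination of increments with all
  coefficients zero is degenerate, so point masses accompany the computation of characteristic
  functions.\<close>

section \<open>Independence from characteristic functions\<close>

text \<open>After division by \<open>p\<close>, the mean of \<open>H\<close>, the hypothesis says
  that \<open>X\<close> has the same characteristic function under \<open>M\<close> and under the
  probability measure with density \<open>H / p\<close>. Levy uniqueness then equates the two laws
  of \<open>X\<close>. If \<open>p = 0\<close>, no such measure exists, but then \<open>H\<close>
  vanishes almost everywhere.\<close>

lemma (in prob_space) integral_indicator_eq_if_char_factor_nonneg:
  fixes X H :: "'a \<Rightarrow> real"
  assumes X[measurable]: "X \<in> borel_measurable M" and H[measurable]: "H \<in> borel_measurable M"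
    and bounds: "\<And>\<omega>. 0 \<le> H \<omega>" "\<And>\<omega>. H \<omega> \<le> C"
    and char: "\<And>t. (\<integral>\<omega>. iexp (t * X \<omega>) * H \<omega> \<partial>M) = (\<integral>\<omega>. iexp (t * X \<omega>) \<partial>M) * (\<integral>\<omega>. H \<omega> \<partial>M)"
    and A[measurable]: "A \<in> sets borel"
  shows "(\<integral>\<omega>. indicator A (X \<omega>) * H \<omega> \<partial>M) = prob (X -` A \<inter> space M) * (\<integral>\<omega>. H \<omega> \<partial>M)"
proof -
  have int: "integrable M H"
    using bounds by (intro integrable_const_bound[where B = C]) auto
  define p where "p = (\<integral>\<omega>. H \<omega> \<partial>M)"
  have "p \<ge> 0"
    unfolding p_def using bounds by simp
  show ?thesis
  proof (cases "p = 0")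
    case True
    then have "AE \<omega> in M. H \<omega> = 0"
      using integral_nonneg_eq_0_iff_AE[OF int] bounds by (auto simp: p_def)
    then have "AE \<omega> in M. indicator A (X \<omega>) * H \<omega> = 0"
      by eventually_elim simp
    then show ?thesis
      using True by (simp add: p_def integral_eq_zero_AE)
  next
    case False
    with \<open>p \<ge> 0\<close> have "p > 0" by simp
    define N where "N = density M (\<lambda>\<omega>. H \<omega> / p)"
    have XN[measurable]: "X \<in> borel_measurable N"
      by (simp add: N_def)
    have nonneg: "AE \<omega> in M. 0 \<le> H \<omega> / p"
      using bounds \<open>p > 0\<close> by simp
    have "prob_space N"
    proof
      have "emeasure N (space N) = (\<integral>\<^sup>+\<omega>. ennreal (H \<omega> / p) \<partial>M)"
        by (simp add: N_def emeasure_density nn_integral_set_ennreal cong: nn_integral_cong)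
      also have "\<dots> = ennreal (\<integral>\<omega>. H \<omega> / p \<partial>M)"
        using int nonneg by (intro nn_integral_eq_integral) auto
      also have "\<dots> = 1"
        using \<open>p > 0\<close> by (simp add: p_def)
      finally show "emeasure N (space N) = 1" .
    qed
    then interpret N: prob_space N .
    have "char (distr N borel X) t = char (distr M borel X) t" for t
    proof -
      have "char (distr N borel X) t = (\<integral>\<omega>. (H \<omega> / p) *\<^sub>R iexp (t * X \<omega>) \<partial>M)"
        unfolding char_def by (subst integral_distr) (auto simp: N_def integral_density bounds \<open>p \<ge> 0\<close>)
      also have "\<dots> = (\<integral>\<omega>. iexp (t * X \<omega>) * H \<omega> \<partial>M) / p"
        by (subst integral_divide_zero[symmetric]) (simp add: scaleR_conv_of_real mult.commute)
      also have "\<dots> = char (distr M borel X) t"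
        using \<open>p > 0\<close> unfolding char char_def by (subst integral_distr) (auto simp: p_def)
      finally show ?thesis .
    qed
    then have eq: "distr N borel X = distr M borel X"
      by (intro Levy_uniqueness real_distribution_distr N.real_distribution_distr ext) auto
    have "prob (X -` A \<inter> space M) = measure (distr N borel X) A"
      by (simp add: eq measure_distr)
    also have "\<dots> = (\<integral>x. indicator A x \<partial>distr N borel X)"
      by simp
    also have "\<dots> = (\<integral>\<omega>. indicator A (X \<omega>) \<partial>N)"
      by (subst integral_distr) auto
    also have "\<dots> = (\<integral>\<omega>. (H \<omega> / p) *\<^sub>R indicator A (X \<omega>) \<partial>M)"
      unfolding N_def using nonneg by (subst integral_density) auto
    also have "\<dots> = (\<integral>\<omega>. indicator A (X \<omega>) * H \<omega> \<partial>M) / p"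
      by (subst integral_divide_zero[symmetric]) (simp add: mult.commute)
    finally show ?thesis
      using \<open>p > 0\<close> by (simp add: p_def field_simps)
  qed
qed

text \<open>Through these formulas a factorization known for exponentials passes to the weights
  \<open>1 + cos S\<close> and \<open>1 + sin S\<close>.\<close>

lemma cos_sin_conv_iexp:
  "complex_of_real (cos x) = (iexp x + iexp (- x)) / 2"
  "complex_of_real (sin x) = (iexp x - iexp (- x)) / (2 * \<i>)"
  using cos_exp_eq[of "complex_of_real x"] sin_exp_eq[of "complex_of_real x"]
  by (simp_all only: cos_of_real sin_of_real of_real_minus mult_minus_right)

text \<open>Levy's uniqueness theorem is applied to the densities \<open>G\<close>, \<open>G (1 + cos S)\<close> and
  \<open>G (1 + sin S)\<close>, which are nonnegative.\<close>

lemma (in prob_space) integral_indicator_iexp_eq_if_char_factor: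
  fixes X G S :: "'a \<Rightarrow> real"
  assumes X[measurable]: "X \<in> borel_measurable M" and G[measurable]: "G \<in> borel_measurable M"
    and S[measurable]: "S \<in> borel_measurable M"
    and bounds: "\<And>\<omega>. 0 \<le> G \<omega>" "\<And>\<omega>. G \<omega> \<le> C"
    and char: "\<And>t r. (\<integral>\<omega>. G \<omega> * iexp (t * X \<omega>) * iexp (r * S \<omega>) \<partial>M) =
      (\<integral>\<omega>. iexp (t * X \<omega>) \<partial>M) * (\<integral>\<omega>. G \<omega> * iexp (r * S \<omega>) \<partial>M)"
    and A[measurable]: "A \<in> sets borel"
  shows "(\<integral>\<omega>. indicator A (X \<omega>) * G \<omega> * iexp (S \<omega>) \<partial>M) =
    prob (X -` A \<inter> space M) * (\<integral>\<omega>. G \<omega> * iexp (S \<omega>) \<partial>M)"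
proof -
  have C: "norm (complex_of_real (G \<omega>)) \<le> C" for \<omega>
    using bounds[of \<omega>] by simp
  have int: "integrable M (\<lambda>\<omega>. G \<omega> * iexp (r * S \<omega>))"
    "integrable M (\<lambda>\<omega>. G \<omega> * iexp (t * X \<omega>) * iexp (r * S \<omega>))" for t r
    using C by (auto intro!: integrable_const_bound[where B = C] simp: norm_mult)
  define p where "p = complex_of_real (prob (X -` A \<inter> space M))"
  \<comment> \<open>A weight \<open>h\<close> with frequencies 0, 1 and -1 in \<open>S\<close> needs
    \<open>char\<close> only at \<open>r = 0\<close>, \<open>r = 1\<close> and
    \<open>r = -1\<close>. Nonnegativity of \<open>h\<close> makes \<open>G * h\<close> a possible
    density; the bound 2 is that of \<open>1 + cos\<close> and \<open>1 + sin\<close>.\<close>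
  have key: "(\<integral>\<omega>. indicator A (X \<omega>) * (G \<omega> * h \<omega>) \<partial>M) = p * (\<integral>\<omega>. G \<omega> * h \<omega> \<partial>M)"
    if h: "\<And>\<omega>. complex_of_real (h \<omega>) = a + b * iexp (S \<omega>) + c * iexp (- S \<omega>)"
      and h_bounds: "\<And>\<omega>. 0 \<le> h \<omega>" "\<And>\<omega>. h \<omega> \<le> 2" and [measurable]: "h \<in> borel_measurable M"
    for h :: "'a \<Rightarrow> real" and a b c
  proof -
    have expand: "(\<integral>\<omega>. iexp (t * X \<omega>) * complex_of_real (G \<omega> * h \<omega>) \<partial>M) =
      a * (\<integral>\<omega>. G \<omega> * iexp (t * X \<omega>) * iexp (0 * S \<omega>) \<partial>M)
      + b * (\<integral>\<omega>. G \<omega> * iexp (t * X \<omega>) * iexp (1 * S \<omega>) \<partial>M)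
      + c * (\<integral>\<omega>. G \<omega> * iexp (t * X \<omega>) * iexp (- 1 * S \<omega>) \<partial>M)" for t
    proof -
      have "(\<integral>\<omega>. iexp (t * X \<omega>) * complex_of_real (G \<omega> * h \<omega>) \<partial>M) =
       (\<integral>\<omega>. a * (G \<omega> * iexp (t * X \<omega>) * iexp (0 * S \<omega>))
        + b * (G \<omega> * iexp (t * X \<omega>) * iexp (1 * S \<omega>))
        + c * (G \<omega> * iexp (t * X \<omega>) * iexp (- 1 * S \<omega>)) \<partial>M)"
        by (intro Bochner_Integration.integral_cong) (simp_all add: h algebra_simps)
      also have "\<dots> = a * (\<integral>\<omega>. G \<omega> * iexp (t * X \<omega>) * iexp (0 * S \<omega>) \<partial>M)
      + b * (\<integral>\<omega>. G \<omega> * iexp (t * X \<omega>) * iexp (1 * S \<omega>) \<partial>M)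
      + c * (\<integral>\<omega>. G \<omega> * iexp (t * X \<omega>) * iexp (- 1 * S \<omega>) \<partial>M)"
        by (subst Bochner_Integration.integral_add,
            intro Bochner_Integration.integrable_add integrable_mult_right int,
            intro integrable_mult_right int,
            subst Bochner_Integration.integral_add,
            intro integrable_mult_right int, intro integrable_mult_right int,
            unfold integral_mult_right_zero, rule refl)
      finally show ?thesis .
    qed
    have "(\<integral>\<omega>. iexp (t * X \<omega>) * complex_of_real (G \<omega> * h \<omega>) \<partial>M) =
        (\<integral>\<omega>. iexp (t * X \<omega>) \<partial>M) * complex_of_real (\<integral>\<omega>. G \<omega> * h \<omega> \<partial>M)" for t
    proof -
      \<comment> \<open>At \<open>t = 0\<close> the expansion yields the mean of
        \<open>G * h\<close>, which is the second factor of the claim.\<close>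
      have "complex_of_real (\<integral>\<omega>. G \<omega> * h \<omega> \<partial>M) =
          (\<integral>\<omega>. iexp (0 * X \<omega>) * complex_of_real (G \<omega> * h \<omega>) \<partial>M)"
        by (simp del: of_real_mult flip: integral_complex_of_real)
      also note expand
      finally show ?thesis
        unfolding expand char by (simp add: prob_space algebra_simps)
    qed
    moreover have "0 \<le> G \<omega> * h \<omega>" "G \<omega> * h \<omega> \<le> C * 2" for \<omega>
      using bounds[of \<omega>] h_bounds[of \<omega>] by (auto intro!: mult_mono)
    ultimately have "(\<integral>\<omega>. indicator A (X \<omega>) * (G \<omega> * h \<omega>) \<partial>M) =
        prob (X -` A \<inter> space M) * (\<integral>\<omega>. G \<omega> * h \<omega> \<partial>M)"
      by (intro integral_indicator_eq_if_char_factor_nonneg[where C = "C * 2"]) auto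
    then show ?thesis
      unfolding p_def by (simp flip: of_real_mult)
  qed
  have C': "\<bar>indicator A (X \<omega>) * G \<omega> * f\<bar> \<le> C" "\<bar>G \<omega> * f\<bar> \<le> C" if "\<bar>f\<bar> \<le> 1" for \<omega> f
    using bounds[of \<omega>] that mult_mono[of "\<bar>G \<omega>\<bar>" C "\<bar>f\<bar>" 1]
    by (auto simp: abs_mult indicator_def)
  have intr: "integrable M (\<lambda>\<omega>. indicator A (X \<omega>) * G \<omega> * f (S \<omega>))"
    "integrable M (\<lambda>\<omega>. G \<omega> * f (S \<omega>))"
    if "\<And>x. \<bar>f x\<bar> \<le> 1" and [measurable]: "f \<in> borel_measurable borel" for f :: "real \<Rightarrow> real"
    using C' that by (auto intro!: integrable_const_bound[where B = C])
  \<comment> \<open>Since \<open>f\<close> changes sign, \<open>G * f S\<close> is no density. The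
    identity is the difference of those for the weights \<open>1 + f\<close> and
    \<open>1\<close>.\<close>
  have trig: "(\<integral>\<omega>. indicator A (X \<omega>) * G \<omega> * f (S \<omega>) \<partial>M) = p * (\<integral>\<omega>. G \<omega> * f (S \<omega>) \<partial>M)"
    if "f = cos \<or> f = sin" for f :: "real \<Rightarrow> real"
  proof -
    have fb: "\<bar>f x\<bar> \<le> 1" "f x \<le> 1" "- 1 \<le> f x" for x
      using that by auto
    have [measurable]: "f \<in> borel_measurable borel"
      using that by auto
    obtain b c where bc: "\<And>x. complex_of_real (f x) = b * iexp x + c * iexp (- x)"
    proof (cases "f = cos")
      case True
      then have "complex_of_real (f x) = (1 / 2) * iexp x + (1 / 2) * iexp (- x)" for x
        by (simp only: cos_sin_conv_iexp(1)) simp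
      then show ?thesis using that by blast
    next
      case False
      with \<open>f = cos \<or> f = sin\<close> have "f = sin" by simp
      then have "complex_of_real (f x) = (1 / (2 * \<i>)) * iexp x + (- 1 / (2 * \<i>)) * iexp (- x)" for x
        by (simp only: cos_sin_conv_iexp(2)) (simp add: algebra_simps divide_simps)
      then show ?thesis using that by blast
    qed
    have i1: "integrable M (\<lambda>\<omega>. indicator A (X \<omega>) * G \<omega>)" "integrable M G"
      using intr[of "\<lambda>_. 1"] by auto
    have "(\<integral>\<omega>. indicator A (X \<omega>) * (G \<omega> * 1) \<partial>M) = p * (\<integral>\<omega>. G \<omega> * 1 \<partial>M)"
      by (rule key[of _ 1 0 0]) auto
    moreover have "(\<integral>\<omega>. indicator A (X \<omega>) * (G \<omega> * (1 + f (S \<omega>))) \<partial>M) =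
        p * (\<integral>\<omega>. G \<omega> * (1 + f (S \<omega>)) \<partial>M)"
    proof (rule key[of _ 1 b c])
      show "0 \<le> 1 + f (S \<omega>)" "1 + f (S \<omega>) \<le> 2" for \<omega>
        using fb[of "S \<omega>"] by linarith+
    qed (simp_all add: bc)
    moreover have "(\<integral>\<omega>. indicator A (X \<omega>) * (G \<omega> * (1 + f (S \<omega>))) \<partial>M) =
        (\<integral>\<omega>. indicator A (X \<omega>) * G \<omega> \<partial>M) + (\<integral>\<omega>. indicator A (X \<omega>) * G \<omega> * f (S \<omega>) \<partial>M)"
      using i1 intr[of f] fb(1) by (simp add: distrib_left flip: mult.assoc)
    moreover have "(\<integral>\<omega>. G \<omega> * (1 + f (S \<omega>)) \<partial>M) =
        (\<integral>\<omega>. G \<omega> \<partial>M) + (\<integral>\<omega>. G \<omega> * f (S \<omega>) \<partial>M)"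
      using i1 intr[of f] fb(1) by (simp add: distrib_left)
    ultimately show ?thesis
      by (simp add: distrib_left)
  qed
  have split: "(\<integral>\<omega>. complex_of_real (g \<omega>) * iexp (S \<omega>) \<partial>M) =
      complex_of_real (\<integral>\<omega>. g \<omega> * cos (S \<omega>) \<partial>M) + \<i> * complex_of_real (\<integral>\<omega>. g \<omega> * sin (S \<omega>) \<partial>M)"
    if "integrable M (\<lambda>\<omega>. g \<omega> * cos (S \<omega>))" "integrable M (\<lambda>\<omega>. g \<omega> * sin (S \<omega>))" for g
  proof -
    have "(\<integral>\<omega>. complex_of_real (g \<omega>) * iexp (S \<omega>) \<partial>M) =
       (\<integral>\<omega>. complex_of_real (g \<omega> * cos (S \<omega>)) + \<i> * complex_of_real (g \<omega> * sin (S \<omega>)) \<partial>M)"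
      by (intro Bochner_Integration.integral_cong)
         (simp_all add: exp_Euler cos_of_real sin_of_real algebra_simps)
    also have "\<dots> = complex_of_real (\<integral>\<omega>. g \<omega> * cos (S \<omega>) \<partial>M) + \<i> * complex_of_real (\<integral>\<omega>. g \<omega> * sin (S \<omega>) \<partial>M)"
      using that by (subst Bochner_Integration.integral_add) (simp_all del: of_real_mult)
    finally show ?thesis .
  qed
  show ?thesis
    using split[of "\<lambda>\<omega>. indicator A (X \<omega>) * G \<omega>"] split[of G] intr[of cos] intr[of sin]
      trig[of cos] trig[of sin]
    by (simp add: p_def algebra_simps)
qed

text \<open>The set \<open>J\<close> collects the variables whose exponentials have already become
  indicators. For empty \<open>J\<close> the formula is the hypothesis; with all remaining
  frequencies set to 0 it is the product rule for the events indexed by \<open>J\<close>.\<close>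

lemma (in prob_space) indep_vars_if_char_factor:
  fixes X :: "'i \<Rightarrow> 'a \<Rightarrow> real"
  assumes I: "finite I"
    and X: "\<And>i. i \<in> I \<Longrightarrow> X i \<in> borel_measurable M"
    and char: "\<And>t. (\<integral>\<omega>. iexp (\<Sum>i\<in>I. t i * X i \<omega>) \<partial>M) = (\<Prod>i\<in>I. \<integral>\<omega>. iexp (t i * X i \<omega>) \<partial>M)"
  shows "indep_vars (\<lambda>_. borel) X I"
proof -
  note [measurable] = X
  \<comment> \<open>The frequencies \<open>t\<close> stay arbitrary in the induction, because the
    step varies the one at the new index and rescales the others.\<close>
  have factor: "(\<integral>\<omega>. complex_of_real (\<Prod>i\<in>J. indicator (A i) (X i \<omega>)) * iexp (\<Sum>i\<in>I - J. t i * X i \<omega>) \<partial>M) =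
      complex_of_real (\<Prod>i\<in>J. prob (X i -` A i \<inter> space M)) * (\<Prod>i\<in>I - J. \<integral>\<omega>. iexp (t i * X i \<omega>) \<partial>M)"
    if "finite J" "J \<subseteq> I" "\<And>i. i \<in> J \<Longrightarrow> A i \<in> sets borel" for J A t
    using that
  proof (induction J arbitrary: t rule: finite_induct)
    case empty
    then show ?case using char by simp
  next
    case (insert m J)
    then have "m \<in> I" and JI: "J \<subseteq> I" and [measurable]: "A m \<in> sets borel" "\<And>i. i \<in> J \<Longrightarrow> A i \<in> sets borel"
      by auto
    then have [measurable]: "X m \<in> borel_measurable M" "\<And>i. i \<in> J \<Longrightarrow> X i \<in> borel_measurable M"
      "\<And>i. i \<in> I - insert m J \<Longrightarrow> X i \<in> borel_measurable M"
      by auto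
    define G where "G = (\<lambda>\<omega>. \<Prod>i\<in>J. indicator (A i) (X i \<omega>) :: real)"
    define S where "S = (\<lambda>\<omega>. \<Sum>i\<in>I - insert m J. t i * X i \<omega>)"
    have [measurable]: "G \<in> borel_measurable M" "S \<in> borel_measurable M"
      unfolding G_def S_def by measurable
    have G: "0 \<le> G \<omega>" "G \<omega> \<le> 1" for \<omega>
      unfolding G_def by (auto intro!: prod_nonneg prod_le_1 simp: indicator_def)
    have decomp: "I - J = insert m (I - insert m J)"
      using \<open>m \<in> I\<close> \<open>m \<notin> J\<close> by auto
    have m: "m \<notin> I - insert m J" by simp
    \<comment> \<open>This is the induction hypothesis with frequency \<open>u\<close> at
      \<open>m\<close> and \<open>r * t i\<close> elsewhere. The scaling by \<open>r\<close>
      supplies all multiples of \<open>S\<close>, as the exchange of one exponential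
      requires.\<close>
    have joint: "(\<integral>\<omega>. G \<omega> * iexp (u * X m \<omega>) * iexp (r * S \<omega>) \<partial>M) =
      complex_of_real (\<Prod>i\<in>J. prob (X i -` A i \<inter> space M)) *
      (\<integral>\<omega>. iexp (u * X m \<omega>) \<partial>M) * (\<Prod>i\<in>I - insert m J. \<integral>\<omega>. iexp (r * t i * X i \<omega>) \<partial>M)" for u r
    proof -
      let ?t = "\<lambda>i. if i = m then u else r * t i"
      have "(\<Sum>i\<in>I - J. ?t i * X i \<omega>) = u * X m \<omega> + r * S \<omega>" for \<omega>
        unfolding decomp S_def using I m
        by (subst sum.insert) (auto simp: sum_distrib_left mult.assoc intro!: sum.cong)
      then have "(\<integral>\<omega>. G \<omega> * iexp (u * X m \<omega>) * iexp (r * S \<omega>) \<partial>M) =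
          (\<integral>\<omega>. complex_of_real (\<Prod>i\<in>J. indicator (A i) (X i \<omega>)) * iexp (\<Sum>i\<in>I - J. ?t i * X i \<omega>) \<partial>M)"
        by (simp only: G_def of_real_add distrib_left exp_add mult.assoc)
      also have "\<dots> = complex_of_real (\<Prod>i\<in>J. prob (X i -` A i \<inter> space M)) *
          (\<Prod>i\<in>I - J. \<integral>\<omega>. iexp (?t i * X i \<omega>) \<partial>M)"
        using insert.prems by (intro insert.IH JI) auto
      also have "(\<Prod>i\<in>I - J. \<integral>\<omega>. iexp (?t i * X i \<omega>) \<partial>M) =
        (\<integral>\<omega>. iexp (u * X m \<omega>) \<partial>M) * (\<Prod>i\<in>I - insert m J. \<integral>\<omega>. iexp (r * t i * X i \<omega>) \<partial>M)"
        unfolding decomp using I m by (subst prod.insert) (auto intro!: prod.cong)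
      finally show ?thesis by (simp only: mult.assoc)
    qed
    have "(\<integral>\<omega>. indicator (A m) (X m \<omega>) * G \<omega> * iexp (S \<omega>) \<partial>M) =
      prob (X m -` A m \<inter> space M) * (\<integral>\<omega>. G \<omega> * iexp (S \<omega>) \<partial>M)"
    proof (rule integral_indicator_iexp_eq_if_char_factor[where C = 1])
      \<comment> \<open>The case \<open>u = 0\<close> identifies the remaining product with the mean
        of \<open>G * iexp (r * S)\<close>.\<close>
      show "(\<integral>\<omega>. G \<omega> * iexp (u * X m \<omega>) * iexp (r * S \<omega>) \<partial>M) =
        (\<integral>\<omega>. iexp (u * X m \<omega>) \<partial>M) * (\<integral>\<omega>. G \<omega> * iexp (r * S \<omega>) \<partial>M)" for u r
        using joint[of u r] joint[of 0 r] by (simp add: prob_space)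
    qed (use G in auto)
    also have "(\<integral>\<omega>. G \<omega> * iexp (S \<omega>) \<partial>M) = complex_of_real (\<Prod>i\<in>J. prob (X i -` A i \<inter> space M)) *
       (\<Prod>i\<in>I - insert m J. \<integral>\<omega>. iexp (t i * X i \<omega>) \<partial>M)"
      using joint[of 0 1] by (simp add: prob_space)
    finally show ?case
      using insert.hyps by (simp add: G_def S_def mult.assoc)
  qed
  have prob: "prob (\<Inter>i\<in>J. X i -` A i \<inter> space M) = (\<Prod>i\<in>J. prob (X i -` A i \<inter> space M))"
    if J: "J \<noteq> {}" "J \<subseteq> I" "\<And>i. i \<in> J \<Longrightarrow> A i \<in> sets borel" for J A
  proof -
    have "finite J" using J I finite_subset by auto
    have [measurable]: "\<And>i. i \<in> J \<Longrightarrow> X i \<in> borel_measurable M" "\<And>i. i \<in> J \<Longrightarrow> A i \<in> sets borel"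
      using J by auto
    have "(\<integral>\<omega>. complex_of_real (\<Prod>i\<in>J. indicator (A i) (X i \<omega>)) * iexp (\<Sum>i\<in>I - J. 0 * X i \<omega>) \<partial>M) =
      complex_of_real (\<Prod>i\<in>J. prob (X i -` A i \<inter> space M)) * (\<Prod>i\<in>I - J. \<integral>\<omega>. iexp (0 * X i \<omega>) \<partial>M)"
      using J \<open>finite J\<close> by (intro factor) auto
    then have "complex_of_real (\<integral>\<omega>. (\<Prod>i\<in>J. indicator (A i) (X i \<omega>)) \<partial>M) =
      complex_of_real (\<Prod>i\<in>J. prob (X i -` A i \<inter> space M))"
      by (simp add: prob_space del: of_real_prod)
    then have "(\<Prod>i\<in>J. prob (X i -` A i \<inter> space M)) = (\<integral>\<omega>. (\<Prod>i\<in>J. indicator (A i) (X i \<omega>)) \<partial>M)"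
      by (simp only: of_real_eq_iff)
    also have "\<dots> = (\<integral>\<omega>. indicator (\<Inter>i\<in>J. X i -` A i \<inter> space M) \<omega> \<partial>M)"
    proof (intro Bochner_Integration.integral_cong refl)
      fix \<omega> assume "\<omega> \<in> space M"
      then show "(\<Prod>i\<in>J. indicator (A i) (X i \<omega>)) = (indicator (\<Inter>i\<in>J. X i -` A i \<inter> space M) \<omega> :: real)"
        using \<open>finite J\<close> by (auto simp: indicator_def prod_zero_iff)
    qed
    also have "\<dots> = prob (\<Inter>i\<in>J. X i -` A i \<inter> space M)"
      using \<open>J \<noteq> {}\<close> \<open>finite J\<close> by simp
    finally show ?thesis by simp
  qed
  show ?thesis
    unfolding indep_vars_def2
  proof (intro conjI ballI indep_setsI)
    fix A J assume J: "J \<noteq> {}" "J \<subseteq> I" "finite J"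
      and "\<forall>j\<in>J. A j \<in> {X j -` A \<inter> space M |A. A \<in> sets borel}"
    then have "\<forall>j\<in>J. \<exists>C. A j = X j -` C \<inter> space M \<and> C \<in> sets borel" by auto
    then obtain C where C: "\<And>j. j \<in> J \<Longrightarrow> A j = X j -` C j \<inter> space M" "\<And>j. j \<in> J \<Longrightarrow> C j \<in> sets borel"
      by metis
    have "prob (\<Inter>j\<in>J. X j -` C j \<inter> space M) = (\<Prod>j\<in>J. prob (X j -` C j \<inter> space M))"
      by (rule prob) (use J C in auto)
    then show "prob (\<Inter>j\<in>J. A j) = (\<Prod>j\<in>J. prob (A j))"
      using C by (simp cong: INF_cong)
  qed (use X in \<open>auto intro: measurable_sets\<close>)
qed

section \<open>Real Gaussian processes with homogeneous increments\<close>

lemma (in prob_space) integrable_product_if_homogeneous: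
  fixes Y :: "real \<Rightarrow> 'a \<Rightarrow> real"
  assumes Y: "\<And>t. 0 \<le> t \<Longrightarrow> Y t \<in> borel_measurable M"
    and sq: "\<And>t. 0 \<le> t \<Longrightarrow> integrable M (\<lambda>\<omega>. (Y t \<omega>)\<^sup>2)"
    and second: "\<And>t. 0 \<le> t \<Longrightarrow> expectation (\<lambda>\<omega>. (Y t \<omega>)\<^sup>2) = t"
    and hom: "\<And>s t. 0 \<le> s \<Longrightarrow> s < t \<Longrightarrow>
      distr M borel (\<lambda>\<omega>. Y t \<omega> - Y s \<omega>) = distr M borel (Y (t - s))"
    and s: "0 \<le> s" and t: "0 \<le> t"
  shows "integrable M (\<lambda>\<omega>. Y s \<omega> * Y t \<omega>)" "expectation (\<lambda>\<omega>. Y s \<omega> * Y t \<omega>) = min s t"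
proof -
  \<comment> \<open>Homogeneity speaks of \<open>s < t\<close> only; the opposite order follows by
    symmetry, and equal times are the second moment. Integrability of the squared increment, like
    its mean, depends on the law alone and so moves along \<open>hom\<close>.\<close>
  have "integrable M (\<lambda>\<omega>. Y s \<omega> * Y t \<omega>) \<and> expectation (\<lambda>\<omega>. Y s \<omega> * Y t \<omega>) = s"
    if "0 \<le> s" "s < t" for s t
  proof -
    have [measurable]: "Y s \<in> borel_measurable M" "Y t \<in> borel_measurable M" "Y (t - s) \<in> borel_measurable M"
      using that Y by auto
    have "integrable M (\<lambda>\<omega>. (Y t \<omega> - Y s \<omega>)\<^sup>2) \<longleftrightarrow> integrable (distr M borel (\<lambda>\<omega>. Y t \<omega> - Y s \<omega>)) (\<lambda>x. x\<^sup>2)"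
      by (subst integrable_distr_eq) auto
    also have "\<dots>"
      unfolding hom[OF that] using sq[of "t - s"] that by (subst integrable_distr_eq) auto
    finally have int: "integrable M (\<lambda>\<omega>. (Y t \<omega> - Y s \<omega>)\<^sup>2)" .
    have "expectation (\<lambda>\<omega>. (Y t \<omega> - Y s \<omega>)\<^sup>2) = (\<integral>x. x\<^sup>2 \<partial>distr M borel (\<lambda>\<omega>. Y t \<omega> - Y s \<omega>))"
      by (subst integral_distr) auto
    also have "\<dots> = t - s"
      unfolding hom[OF that] using second[of "t - s"] that by (subst integral_distr) auto
    finally have diff: "expectation (\<lambda>\<omega>. (Y t \<omega> - Y s \<omega>)\<^sup>2) = t - s" .
    have polar: "Y s \<omega> * Y t \<omega> = ((Y s \<omega>)\<^sup>2 + (Y t \<omega>)\<^sup>2 - (Y t \<omega> - Y s \<omega>)\<^sup>2) / 2" for \<omega>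
      by (simp add: power2_eq_square algebra_simps)
    show ?thesis
      unfolding polar using sq[of s] sq[of t] second[of s] second[of t] int diff that by simp
  qed
  note less = this
  show "integrable M (\<lambda>\<omega>. Y s \<omega> * Y t \<omega>)" "expectation (\<lambda>\<omega>. Y s \<omega> * Y t \<omega>) = min s t"
    using less[of s t] less[of t s] sq[of s] second[of s] s t
    by (cases s t rule: linorder_cases; simp add: power2_eq_square mult.commute)+
qed

lemma (in prob_space) expectation_zero_if_homogeneous:
  fixes Y :: "real \<Rightarrow> 'a \<Rightarrow> real"
  assumes Y: "\<And>t. 0 \<le> t \<Longrightarrow> Y t \<in> borel_measurable M"
    and sq: "\<And>t. 0 \<le> t \<Longrightarrow> integrable M (\<lambda>\<omega>. (Y t \<omega>)\<^sup>2)"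
    and second: "\<And>t. 0 \<le> t \<Longrightarrow> expectation (\<lambda>\<omega>. (Y t \<omega>)\<^sup>2) = t"
    and hom: "\<And>s t. 0 \<le> s \<Longrightarrow> s < t \<Longrightarrow>
      distr M borel (\<lambda>\<omega>. Y t \<omega> - Y s \<omega>) = distr M borel (Y (t - s))"
    and t: "0 \<le> t"
  shows "expectation (Y t) = 0"
proof -
  define m where "m = (\<lambda>t. expectation (Y t))"
  have int: "integrable M (Y t)" if "0 \<le> t" for t
    using square_integrable_imp_integrable[OF Y sq] that by blast
  \<comment> \<open>Nonnegativity of the variance.\<close>
  have bound: "(m t)\<^sup>2 \<le> t" if "0 \<le> t" for t
    using variance_positive[of "Y t"] variance_eq[OF int sq] second that by (simp add: m_def)
  have add: "m t = m s + m (t - s)" if "0 \<le> s" "s < t" for s t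
  proof -
    have [measurable]: "Y s \<in> borel_measurable M" "Y t \<in> borel_measurable M" "Y (t - s) \<in> borel_measurable M"
      using that Y by auto
    have "m t - m s = expectation (\<lambda>\<omega>. Y t \<omega> - Y s \<omega>)"
      using int that by (simp add: m_def)
    also have "\<dots> = (\<integral>x. x \<partial>distr M borel (\<lambda>\<omega>. Y t \<omega> - Y s \<omega>))"
      by (subst integral_distr) auto
    also have "\<dots> = m (t - s)"
      unfolding hom[OF that] m_def by (subst integral_distr) auto
    finally show ?thesis by simp
  qed
  have zero: "m 0 = 0"
    using bound[of 0] by simp
  have mult: "m (real n * t) = real n * m t" if "0 < t" for n
  proof (induction n)
    case (Suc n)
    have "m (real (Suc n) * t) = m (real n * t) + m t"
      using add[of "real n * t" "real (Suc n) * t"] that by (simp add: algebra_simps)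
    then show ?case
      using Suc by (simp add: algebra_simps)
  qed (simp add: zero)
  have "m t = 0"
  proof (cases "t = 0")
    case False
    with t have "0 < t" by simp
    show ?thesis
    proof (rule ccontr)
      assume "m t \<noteq> 0"
      \<comment> \<open>Along the multiples of \<open>t\<close> the mean grows linearly but is
        bounded by a square root: \<open>bound\<close> at \<open>n * t\<close> gives
        \<open>n\<^sup>2 * (m t)\<^sup>2 \<le> n * t\<close>, which this \<open>n\<close>
        violates.\<close>
      then obtain n where n: "t < real n * (m t)\<^sup>2"
        using reals_Archimedean3[of "(m t)\<^sup>2"] by auto
      then have "n > 0" using \<open>0 < t\<close> by (intro gr0I) auto
      have "(real n)\<^sup>2 * (m t)\<^sup>2 \<le> real n * t"
        using bound[of "real n * t"] mult[OF \<open>0 < t\<close>, of n] \<open>0 < t\<close> by (simp add: power_mult_distrib)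
      then show False
        using n \<open>n > 0\<close> by (simp add: power2_eq_square)
    qed
  qed (simp add: zero)
  then show ?thesis by (simp add: m_def)
qed

text \<open>Mean zero forces the centre of either kind of Gaussian law to be 0, after which the
  second moment alone determines the law. Both the characteristic function and the law of an
  increment are read off from this.\<close>

lemma (in prob_space) gaussian_rv_centered_cases:
  assumes "gaussian_rv M Z" "expectation Z = 0"
  obtains "AE \<omega> in M. Z \<omega> = 0" "expectation (\<lambda>\<omega>. (Z \<omega>)\<^sup>2) = 0"
  | \<sigma> where "\<sigma> > 0" "distributed M lborel Z (normal_density 0 \<sigma>)" "expectation (\<lambda>\<omega>. (Z \<omega>)\<^sup>2) = \<sigma>\<^sup>2"
proof -
  have [measurable]: "Z \<in> borel_measurable M"
    using assms by (simp add: gaussian_rv_def)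
  from assms(1) consider (const) \<mu> where "AE \<omega> in M. Z \<omega> = \<mu>"
    | (normal) \<mu> \<sigma> where "\<sigma> > 0" "distributed M lborel Z (normal_density \<mu> \<sigma>)"
    unfolding gaussian_rv_def by blast
  then show thesis
  proof cases
    case const
    then have "expectation Z = expectation (\<lambda>_. \<mu>)"
      by (intro integral_cong_AE) auto
    then have "\<mu> = 0" using assms(2) by (simp add: prob_space)
    with const have zero: "AE \<omega> in M. Z \<omega> = 0" by simp
    then have "AE \<omega> in M. (Z \<omega>)\<^sup>2 = 0" by eventually_elim simp
    then show ?thesis
      using that(1) zero by (simp add: integral_eq_zero_AE)
  next
    case normal
    then have "\<mu> = 0"
      using normal_distributed_expectation assms(2) by simp
    then show ?thesis
      using that(2) normal normal_distributed_variance[OF normal] assms(2) by simp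
  qed
qed

text \<open>Frequency 1 is enough: the coefficients are absorbed into \<open>Z\<close>, which will
  be an arbitrary linear combination of increments.\<close>

lemma (in prob_space) gaussian_rv_char:
  assumes "gaussian_rv M Z" "expectation Z = 0"
  shows "(\<integral>\<omega>. iexp (Z \<omega>) \<partial>M) = exp (- expectation (\<lambda>\<omega>. (Z \<omega>)\<^sup>2) / 2)"
  using assms
proof (cases rule: gaussian_rv_centered_cases)
  case 1
  have [measurable]: "Z \<in> borel_measurable M"
    using assms by (simp add: gaussian_rv_def)
  have "(\<integral>\<omega>. iexp (Z \<omega>) \<partial>M) = (\<integral>\<omega>. 1 \<partial>M)"
    using 1(1) by (intro integral_cong_AE) auto
  then show ?thesis using 1(2) by (simp add: prob_space)
next
  case (2 \<sigma>)
  have [measurable]: "Z \<in> borel_measurable M"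
    using assms by (simp add: gaussian_rv_def)
  have "distributed M lborel (\<lambda>\<omega>. Z \<omega> / \<sigma>) std_normal_density"
    using 2 normal_standard_normal_convert[of \<sigma> Z 0] by simp
  then have "distr M lborel (\<lambda>\<omega>. Z \<omega> / \<sigma>) = std_normal_distribution"
    by (simp add: distributed_def)
  \<comment> \<open>Evaluating at \<open>\<sigma>\<close> undoes the standardization, as
    \<open>\<sigma> * (Z / \<sigma>) = Z\<close>.\<close>
  then have "char (distr M lborel (\<lambda>\<omega>. Z \<omega> / \<sigma>)) \<sigma> = exp (- \<sigma>\<^sup>2 / 2)"
    by (simp add: char_std_normal_distribution)
  also have "char (distr M lborel (\<lambda>\<omega>. Z \<omega> / \<sigma>)) \<sigma> = (\<integral>\<omega>. iexp (Z \<omega>) \<partial>M)"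
    unfolding char_def using \<open>\<sigma> > 0\<close> by (subst integral_distr) auto
  finally show ?thesis using 2 by simp
qed

text \<open>A Gaussian process is defined by sums over sets of times, so the indexed sum of
  increments is regrouped over the image of \<open>\<tau>\<close>; repeated times are merged there.
  The separate bound \<open>N\<close> keeps this set fixed during the induction on
  \<open>n\<close>.\<close>

lemma linear_combination_increments:
  fixes Y :: "real \<Rightarrow> 'w \<Rightarrow> real" and \<tau> :: "nat \<Rightarrow> real"
  shows "n \<le> N \<Longrightarrow>
    \<exists>c. \<forall>\<omega>. (\<Sum>i<n. a i * (Y (\<tau> (Suc i)) \<omega> - Y (\<tau> i) \<omega>)) = (\<Sum>t\<in>\<tau> ` {..N}. c t * Y t \<omega>)"
proof (induction n)
  case 0
  show ?case by (intro exI[of _ "\<lambda>_. 0"]) simp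
next
  case (Suc n)
  then obtain c where c: "\<And>\<omega>. (\<Sum>i<n. a i * (Y (\<tau> (Suc i)) \<omega> - Y (\<tau> i) \<omega>)) = (\<Sum>t\<in>\<tau> ` {..N}. c t * Y t \<omega>)"
    by auto
  define c' where "c' = (\<lambda>t. c t + a n * (if t = \<tau> (Suc n) then 1 else 0) - a n * (if t = \<tau> n then 1 else 0))"
  have mem: "\<tau> (Suc n) \<in> \<tau> ` {..N}" "\<tau> n \<in> \<tau> ` {..N}"
    using Suc.prems by auto
  have "(\<Sum>t\<in>\<tau> ` {..N}. c' t * Y t \<omega>) = (\<Sum>t\<in>\<tau> ` {..N}. c t * Y t \<omega>)
     + (\<Sum>t\<in>\<tau> ` {..N}. if t = \<tau> (Suc n) then a n * Y t \<omega> else 0)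
     - (\<Sum>t\<in>\<tau> ` {..N}. if t = \<tau> n then a n * Y t \<omega> else 0)" for \<omega>
    unfolding sum.distrib[symmetric] sum_subtractf[symmetric] c'_def
    by (intro sum.cong) (auto simp: algebra_simps)
  then have "(\<Sum>i<Suc n. a i * (Y (\<tau> (Suc i)) \<omega> - Y (\<tau> i) \<omega>)) = (\<Sum>t\<in>\<tau> ` {..N}. c' t * Y t \<omega>)" for \<omega>
    using mem by (simp add: c) (simp add: algebra_simps)
  then show ?case by blast
qed

lemma (in prob_space) standard_brownian_motion_if_gaussian:
  fixes Y :: "real \<Rightarrow> 'a \<Rightarrow> real"
  assumes gauss: "gaussian_process M Y"
    and mean: "\<And>t. 0 \<le> t \<Longrightarrow> expectation (Y t) = 0"
    and int: "\<And>s t. 0 \<le> s \<Longrightarrow> 0 \<le> t \<Longrightarrow> integrable M (\<lambda>\<omega>. Y s \<omega> * Y t \<omega>)"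
    and cov: "\<And>s t. 0 \<le> s \<Longrightarrow> 0 \<le> t \<Longrightarrow> expectation (\<lambda>\<omega>. Y s \<omega> * Y t \<omega>) = min s t"
    and start: "AE \<omega> in M. Y 0 \<omega> = 0"
    and cont: "\<And>\<omega>. \<omega> \<in> space M \<Longrightarrow> continuous_on {0..} (\<lambda>t. Y t \<omega>)"
  shows "standard_brownian_motion M Y"
proof -
  have Y: "Y t \<in> borel_measurable M" if "0 \<le> t" for t
    using gauss[unfolded gaussian_process_def, rule_format, of "{t}" "\<lambda>_. 1"] that
    by (simp add: gaussian_rv_def)
  have intY: "integrable M (Y t)" if "0 \<le> t" for t
    using square_integrable_imp_integrable[OF Y] int[OF that that] that by (simp add: power2_eq_square)
  have comb: "gaussian_rv M (\<lambda>\<omega>. \<Sum>i<n. a i * (Y (\<tau> (Suc i)) \<omega> - Y (\<tau> i) \<omega>))"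
    if "\<And>i. i \<le> n \<Longrightarrow> 0 \<le> \<tau> i" for \<tau> :: "nat \<Rightarrow> real" and n a
  proof -
    obtain c where "\<And>\<omega>. (\<Sum>i<n. a i * (Y (\<tau> (Suc i)) \<omega> - Y (\<tau> i) \<omega>)) = (\<Sum>t\<in>\<tau> ` {..n}. c t * Y t \<omega>)"
      using linear_combination_increments[of n n a Y \<tau>] by auto
    then show ?thesis
      using gauss[unfolded gaussian_process_def, rule_format, of "\<tau> ` {..n}" c] that by auto
  qed
  \<comment> \<open>For \<open>s \<le> t\<close> and \<open>s' \<le> t'\<close> the right-hand side
    is the length of the overlap of the intervals from \<open>s\<close> to \<open>t\<close> and from
    \<open>s'\<close> to \<open>t'\<close>.\<close>
  have increment_cov: "expectation (\<lambda>\<omega>. (Y t \<omega> - Y s \<omega>) * (Y t' \<omega> - Y s' \<omega>)) =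
      min t t' - min t s' - min s t' + min s s'"
    and increment_int: "integrable M (\<lambda>\<omega>. (Y t \<omega> - Y s \<omega>) * (Y t' \<omega> - Y s' \<omega>))"
    if "0 \<le> s" "0 \<le> t" "0 \<le> s'" "0 \<le> t'" for s t s' t'
    using that int by (simp_all add: left_diff_distrib right_diff_distrib cov)
  have char: "(\<integral>\<omega>. iexp (\<Sum>i<n. a i * (Y (\<tau> (Suc i)) \<omega> - Y (\<tau> i) \<omega>)) \<partial>M) =
      exp (- (\<Sum>i<n. (a i)\<^sup>2 * (\<tau> (Suc i) - \<tau> i)) / 2)"
    and mean_sum: "expectation (\<lambda>\<omega>. \<Sum>i<n. a i * (Y (\<tau> (Suc i)) \<omega> - Y (\<tau> i) \<omega>)) = 0"
    and var_sum: "expectation (\<lambda>\<omega>. (\<Sum>i<n. a i * (Y (\<tau> (Suc i)) \<omega> - Y (\<tau> i) \<omega>))\<^sup>2) =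
      (\<Sum>i<n. (a i)\<^sup>2 * (\<tau> (Suc i) - \<tau> i))"
    if nonneg: "\<And>i. i \<le> n \<Longrightarrow> 0 \<le> \<tau> i" and mono: "\<And>i j. i \<le> j \<Longrightarrow> j \<le> n \<Longrightarrow> \<tau> i \<le> \<tau> j"
    for \<tau> :: "nat \<Rightarrow> real" and n a
  proof -
    let ?D = "\<lambda>i \<omega>. Y (\<tau> (Suc i)) \<omega> - Y (\<tau> i) \<omega>"
    let ?Z = "\<lambda>\<omega>. \<Sum>i<n. a i * ?D i \<omega>"
    \<comment> \<open>For \<open>i < k\<close> the first interval ends at
      \<open>\<tau> (Suc i) \<le> \<tau> k\<close>, so the four minima cancel. Hence only the
      diagonal survives in the variance of the linear combination.\<close>
    have orth: "expectation (\<lambda>\<omega>. ?D i \<omega> * ?D k \<omega>) = (if i = k then \<tau> (Suc i) - \<tau> i else 0)"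
      if "i < n" "k < n" for i k
    proof -
      have "expectation (\<lambda>\<omega>. ?D i \<omega> * ?D k \<omega>) = min (\<tau> (Suc i)) (\<tau> (Suc k)) - min (\<tau> (Suc i)) (\<tau> k)
          - min (\<tau> i) (\<tau> (Suc k)) + min (\<tau> i) (\<tau> k)"
        using that by (intro increment_cov nonneg) auto
      then show ?thesis
        using mono[of i "Suc i"] mono[of k "Suc k"] mono[of "Suc i" k] mono[of "Suc k" i] that
        by (cases i k rule: linorder_cases) auto
    qed
    have intD: "integrable M (\<lambda>\<omega>. ?D i \<omega> * ?D k \<omega>)" if "i < n" "k < n" for i k
      using that by (intro increment_int nonneg) auto
    have sq: "(?Z \<omega>)\<^sup>2 = (\<Sum>i<n. \<Sum>k<n. (a i * a k) * (?D i \<omega> * ?D k \<omega>))" for \<omega>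
      by (simp add: power2_eq_square sum_product mult_ac)
    have "expectation (\<lambda>\<omega>. (?Z \<omega>)\<^sup>2) = (\<Sum>i<n. \<Sum>k<n. (a i * a k) * expectation (\<lambda>\<omega>. ?D i \<omega> * ?D k \<omega>))"
      unfolding sq
      by (subst Bochner_Integration.integral_sum, use intD in force)
         (intro sum.cong refl, subst Bochner_Integration.integral_sum, use intD in auto)
    also have "\<dots> = (\<Sum>i<n. \<Sum>k<n. if k = i then (a i)\<^sup>2 * (\<tau> (Suc i) - \<tau> i) else 0)"
      by (intro sum.cong) (auto simp: orth power2_eq_square)
    also have "\<dots> = (\<Sum>i<n. (a i)\<^sup>2 * (\<tau> (Suc i) - \<tau> i))"
      by (intro sum.cong) (auto simp: sum.delta)
    finally show var: "expectation (\<lambda>\<omega>. (?Z \<omega>)\<^sup>2) = (\<Sum>i<n. (a i)\<^sup>2 * (\<tau> (Suc i) - \<tau> i))" .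
    have "expectation ?Z = (\<Sum>i<n. a i * expectation (?D i))"
      using intY nonneg by (subst Bochner_Integration.integral_sum) auto
    also have "\<dots> = 0"
      using intY nonneg mean by (intro sum.neutral) auto
    finally show mean_Z: "expectation ?Z = 0" .
    show "(\<integral>\<omega>. iexp (?Z \<omega>) \<partial>M) = exp (- (\<Sum>i<n. (a i)\<^sup>2 * (\<tau> (Suc i) - \<tau> i)) / 2)"
      using gaussian_rv_char[OF comb[OF nonneg] mean_Z] var by simp
  qed
  have indep: "indep_vars (\<lambda>_. borel) (\<lambda>i \<omega>. Y (\<tau> (Suc i)) \<omega> - Y (\<tau> i) \<omega>) {..<n}"
    if "0 \<le> \<tau> 0" "\<forall>i<n. \<tau> i < \<tau> (Suc i)" for \<tau> :: "nat \<Rightarrow> real" and n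
  proof -
    \<comment> \<open>Nothing constrains \<open>\<tau>\<close> beyond index \<open>n\<close>, so
      monotonicity is claimed only up to there.\<close>
    have mono: "\<tau> i \<le> \<tau> k" if "i \<le> k" "k \<le> n" for i k
      using that
    proof (induction k rule: dec_induct)
      case (step k)
      with \<open>\<forall>i<n. \<tau> i < \<tau> (Suc i)\<close>[rule_format, of k] show ?case by simp
    qed simp
    have nonneg: "0 \<le> \<tau> i" if "i \<le> n" for i
      using mono[of 0 i] that \<open>0 \<le> \<tau> 0\<close> by simp
    have char': "(\<integral>\<omega>. iexp (\<Sum>i<n. a i * (Y (\<tau> (Suc i)) \<omega> - Y (\<tau> i) \<omega>)) \<partial>M) =
      exp (- (\<Sum>i<n. (a i)\<^sup>2 * (\<tau> (Suc i) - \<tau> i)) / 2)" for a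
      using nonneg mono by (rule char)
    show ?thesis
    proof (rule indep_vars_if_char_factor)
      fix a
      \<comment> \<open>The marginal is the joint formula for coefficients that vanish off
        \<open>i\<close>. The exponent is a sum over the increments, so the joint characteristic
        function is the product of these marginals.\<close>
      have single: "(\<integral>\<omega>. iexp (a i * (Y (\<tau> (Suc i)) \<omega> - Y (\<tau> i) \<omega>)) \<partial>M) =
          exp (- ((a i)\<^sup>2 * (\<tau> (Suc i) - \<tau> i)) / 2)" if "i < n" for i
      proof -
        have "(\<Sum>k<n. (if k = i then a i else 0) * (Y (\<tau> (Suc k)) \<omega> - Y (\<tau> k) \<omega>)) =
            a i * (Y (\<tau> (Suc i)) \<omega> - Y (\<tau> i) \<omega>)" for \<omega>
          using that by (simp add: if_distrib[of "\<lambda>x. x * _"] sum.delta cong: if_cong)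
        moreover have "(\<Sum>k<n. (if k = i then a i else 0)\<^sup>2 * (\<tau> (Suc k) - \<tau> k)) =
            (a i)\<^sup>2 * (\<tau> (Suc i) - \<tau> i)"
          using that by (simp add: if_distrib[of "\<lambda>x. x\<^sup>2 * _"] sum.delta cong: if_cong)
        ultimately show ?thesis
          using char'[of "\<lambda>k. if k = i then a i else 0"] by simp
      qed
      have "(\<integral>\<omega>. iexp (\<Sum>i<n. a i * (Y (\<tau> (Suc i)) \<omega> - Y (\<tau> i) \<omega>)) \<partial>M) =
        exp (\<Sum>i<n. - ((a i)\<^sup>2 * (\<tau> (Suc i) - \<tau> i)) / 2)"
        unfolding char' by (simp add: sum_negf sum_divide_distrib)
      also have "\<dots> = (\<Prod>i<n. \<integral>\<omega>. iexp (a i * (Y (\<tau> (Suc i)) \<omega> - Y (\<tau> i) \<omega>)) \<partial>M)"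
        unfolding exp_sum[OF finite_lessThan] of_real_prod
        by (intro prod.cong refl single[symmetric]) simp
      finally show "(\<integral>\<omega>. iexp (\<Sum>i<n. a i * (Y (\<tau> (Suc i)) \<omega> - Y (\<tau> i) \<omega>)) \<partial>M) =
        (\<Prod>i<n. \<integral>\<omega>. iexp (a i * (Y (\<tau> (Suc i)) \<omega> - Y (\<tau> i) \<omega>)) \<partial>M)" .
    qed (use Y nonneg in auto)
  qed
  have normal: "distributed M lborel (\<lambda>\<omega>. Y t \<omega> - Y s \<omega>) (normal_density 0 (sqrt (t - s)))"
    if "0 \<le> s" "s < t" for s t
  proof -
    \<comment> \<open>A single increment is treated as a chain with one step.\<close>
    define \<tau> where "\<tau> = (\<lambda>i::nat. if i = 0 then s else t)"
    have \<tau>: "\<And>i. i \<le> 1 \<Longrightarrow> 0 \<le> \<tau> i" "\<And>i k. i \<le> k \<Longrightarrow> k \<le> 1 \<Longrightarrow> \<tau> i \<le> \<tau> k"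
      using that by (auto simp: \<tau>_def)
    have "gaussian_rv M (\<lambda>\<omega>. \<Sum>i<1. 1 * (Y (\<tau> (Suc i)) \<omega> - Y (\<tau> i) \<omega>))"
      "expectation (\<lambda>\<omega>. \<Sum>i<1. 1 * (Y (\<tau> (Suc i)) \<omega> - Y (\<tau> i) \<omega>)) = 0"
      "expectation (\<lambda>\<omega>. (\<Sum>i<1. 1 * (Y (\<tau> (Suc i)) \<omega> - Y (\<tau> i) \<omega>))\<^sup>2) =
        (\<Sum>i<1. 1\<^sup>2 * (\<tau> (Suc i) - \<tau> i))"
      by (rule comb, fact \<tau>(1), rule mean_sum, fact \<tau>(1), fact \<tau>(2), rule var_sum, fact \<tau>(1), fact \<tau>(2))
    then have "gaussian_rv M (\<lambda>\<omega>. Y t \<omega> - Y s \<omega>)" "expectation (\<lambda>\<omega>. Y t \<omega> - Y s \<omega>) = 0"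
      and var: "expectation (\<lambda>\<omega>. (Y t \<omega> - Y s \<omega>)\<^sup>2) = t - s"
      by (simp_all add: \<tau>_def)
    from this(1,2) show ?thesis
    \<comment> \<open>A degenerate law is excluded because the second moment \<open>t - s\<close> is
      positive; in the other case that moment fixes \<open>\<sigma>\<close>.\<close>
    proof (cases rule: gaussian_rv_centered_cases)
      case (2 \<sigma>)
      then have "\<sigma> = sqrt (t - s)"
        using var by (simp add: real_sqrt_unique)
      then show ?thesis using 2 by simp
    qed (use var that in simp)
  qed
  show ?thesis
    unfolding standard_brownian_motion_def using Y start indep normal cont by blast
qed

section \<open>Bochner integrability and martingales\<close>

text \<open>Subtraction need not preserve Borel measurability in a nonseparable space. Here
  \<open>g\<close> has finitely many values, and on each level set the function is the norm of
  \<open>f\<close> minus a constant, a continuous function of \<open>f\<close>.\<close>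

lemma measurable_norm_diff_simple:
  fixes f g :: "'w \<Rightarrow> 'b::real_normed_vector"
  assumes f[measurable]: "f \<in> borel_measurable M" and g: "simple_function M g"
  shows "(\<lambda>\<omega>. norm (f \<omega> - g \<omega>)) \<in> borel_measurable M"
proof (rule measurable_compose_countable'[where f = "\<lambda>c \<omega>. norm (f \<omega> - c)" and g = g and I = "g ` space M"])
  show "(\<lambda>\<omega>. norm (f \<omega> - c)) \<in> borel_measurable M" for c
    by (rule measurable_compose[OF f]) (intro borel_measurable_continuous_onI continuous_intros)
  show "countable (g ` space M)"
    using g by (simp add: simple_function_def countable_finite)
  show "g \<in> measurable M (count_space (g ` space M))"
    using g by (auto simp: simple_function_def intro!: measurable_count_space_eq2[THEN iffD2])
qed

lemma strongly_measurable_norm: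
  "strongly_measurable M f \<Longrightarrow> (\<lambda>\<omega>. norm (f \<omega>)) \<in> borel_measurable M"
  using measurable_compose[of f M borel norm borel]
  by (simp add: strongly_measurable_def borel_measurable_continuous_onI continuous_on_norm)

lemma bochner_integrable_integrable_norm:
  assumes "bochner_integrable M f"
  shows "integrable M (\<lambda>\<omega>. norm (f \<omega>))"
proof -
  from assms obtain s where f: "strongly_measurable M f"
    and s: "\<And>i. Bochner_Integration.simple_bochner_integrable M (s i)"
    and lim: "(\<lambda>i. \<integral>\<^sup>+\<omega>. norm (f \<omega> - s i \<omega>) \<partial>M) \<longlonglongrightarrow> 0"
    unfolding bochner_integrable_def by blast
  have sf: "simple_function M (s i)" for i
    using s[of i] by (rule Bochner_Integration.simple_bochner_integrable.cases)
  have [measurable]: "(\<lambda>\<omega>. norm (f \<omega>)) \<in> borel_measurable M"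
    by (rule strongly_measurable_norm[OF f])
  have [measurable]: "(\<lambda>\<omega>. norm (f \<omega> - s i \<omega>)) \<in> borel_measurable M" for i
    using f sf by (auto simp: strongly_measurable_def intro: measurable_norm_diff_simple)
  have [measurable]: "(\<lambda>\<omega>. norm (s i \<omega>)) \<in> borel_measurable M" for i
    by (rule borel_measurable_simple_function[OF simple_function_compose1[OF sf]])
  \<comment> \<open>One approximant at finite distance suffices, by the triangle inequality; 1 is an
    arbitrary finite bound.\<close>
  from lim have "\<forall>\<^sub>F i in sequentially. (\<integral>\<^sup>+\<omega>. norm (f \<omega> - s i \<omega>) \<partial>M) < 1"
    by (rule order_tendstoD) simp
  then obtain i where i: "(\<integral>\<^sup>+\<omega>. norm (f \<omega> - s i \<omega>) \<partial>M) < 1"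
    by (auto simp: eventually_sequentially)
  have "(\<integral>\<^sup>+\<omega>. norm (s i \<omega>) \<partial>M) < \<infinity>"
  proof -
    \<comment> \<open>The sum over the finitely many values is a crude bound for the norm of
      \<open>s i\<close>, whose support has finite measure.\<close>
    define c where "c = (\<Sum>y\<in>s i ` space M. norm y)"
    have "finite (s i ` space M)"
      using sf by (simp add: simple_function_def)
    then have "norm (s i \<omega>) \<le> c" if "\<omega> \<in> space M" for \<omega>
      unfolding c_def using that by (intro member_le_sum) auto
    then have "(\<integral>\<^sup>+\<omega>. norm (s i \<omega>) \<partial>M) \<le>
        (\<integral>\<^sup>+\<omega>. ennreal c * indicator {y\<in>space M. s i y \<noteq> 0} \<omega> \<partial>M)"
      by (intro nn_integral_mono) (auto simp: indicator_def intro: ennreal_leI)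
    also have "\<dots> = ennreal c * emeasure M {y\<in>space M. s i y \<noteq> 0}"
    proof (rule nn_integral_cmult_indicator)
      have "{y\<in>space M. norm (s i y) \<noteq> 0} \<in> sets M" by measurable
      then show "{y\<in>space M. s i y \<noteq> 0} \<in> sets M" by simp
    qed
    also have "\<dots> < \<infinity>"
      using s[of i] by (auto simp: simple_bochner_integrable.simps ennreal_mult_less_top top.not_eq_extremum)
    finally show ?thesis .
  qed
  have "(\<integral>\<^sup>+\<omega>. norm (f \<omega>) \<partial>M) \<le> (\<integral>\<^sup>+\<omega>. ennreal (norm (f \<omega> - s i \<omega>)) + ennreal (norm (s i \<omega>)) \<partial>M)"
  proof (intro nn_integral_mono)
    show "ennreal (norm (f \<omega>)) \<le> ennreal (norm (f \<omega> - s i \<omega>)) + ennreal (norm (s i \<omega>))" for \<omega>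
      using norm_triangle_sub[of "f \<omega>" "s i \<omega>"]
      by (simp add: add.commute ennreal_leI flip: ennreal_plus)
  qed
  also have "\<dots> = (\<integral>\<^sup>+\<omega>. norm (f \<omega> - s i \<omega>) \<partial>M) + (\<integral>\<^sup>+\<omega>. norm (s i \<omega>) \<partial>M)"
    by (rule nn_integral_add) auto
  also have "\<dots> < \<infinity>"
    using i \<open>(\<integral>\<^sup>+\<omega>. norm (s i \<omega>) \<partial>M) < \<infinity>\<close> by (auto simp: less_top[symmetric] top_unique)
  finally show ?thesis
    by (intro integrableI_bounded) auto
qed

lemma bochner_integrable_bounded_linear:
  fixes \<phi> :: "'b::real_normed_vector \<Rightarrow> real"
  assumes f: "bochner_integrable M f" and \<phi>: "bounded_linear \<phi>"
  shows "integrable M (\<lambda>\<omega>. \<phi> (f \<omega>))"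
proof -
  obtain K where K: "\<And>x. norm (\<phi> x) \<le> norm x * K"
    using \<phi> bounded_linear.bounded by blast
  have "f \<in> borel_measurable M"
    using f by (simp add: bochner_integrable_def strongly_measurable_def)
  then have "(\<lambda>\<omega>. \<phi> (f \<omega>)) \<in> borel_measurable M"
    by (rule measurable_compose)
       (intro borel_measurable_continuous_onI bounded_linear.continuous_on[OF \<phi>] continuous_on_id)
  moreover have "integrable M (\<lambda>\<omega>. norm (f \<omega>) * K)"
    using bochner_integrable_integrable_norm[OF f] by simp
  ultimately show ?thesis
    using K by (elim Bochner_Integration.integrable_bound) (auto intro: order_trans abs_ge_self)
qed

text \<open>The approximating simple functions are cut off where their norm exceeds twice that of
  the limit, which makes them dominated.\<close>

lemma (in finite_measure) bochner_integrableI_norm: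
  fixes f :: "'a \<Rightarrow> 'b::real_normed_vector"
  assumes f: "strongly_measurable M f" and int: "integrable M (\<lambda>\<omega>. norm (f \<omega>))"
  shows "bochner_integrable M f"
proof -
  obtain s where s: "\<And>i. simple_function M (s i)" and lim: "AE \<omega> in M. (\<lambda>i. s i \<omega>) \<longlonglongrightarrow> f \<omega>"
    using f unfolding strongly_measurable_def by blast
  have [measurable]: "(\<lambda>\<omega>. norm (f \<omega>)) \<in> borel_measurable M"
    by (rule strongly_measurable_norm[OF f])
  have [measurable]: "(\<lambda>\<omega>. norm (s i \<omega>)) \<in> borel_measurable M" for i
    by (rule borel_measurable_simple_function[OF simple_function_compose1[OF s]])
  define s' where "s' = (\<lambda>i \<omega>. if norm (s i \<omega>) \<le> 2 * norm (f \<omega>) then s i \<omega> else 0)"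
  have s': "simple_function M (s' i)" for i
    unfolding s'_def by (intro simple_function_If s simple_function_const) measurable
  have [measurable]: "(\<lambda>\<omega>. norm (f \<omega> - s' i \<omega>)) \<in> borel_measurable M" for i
    using f s' by (auto simp: strongly_measurable_def intro: measurable_norm_diff_simple)
  have lim': "AE \<omega> in M. (\<lambda>i. ennreal (norm (f \<omega> - s' i \<omega>))) \<longlonglongrightarrow> 0"
    using lim
  proof eventually_elim
    case (elim \<omega>)
    have "(\<lambda>i. s' i \<omega>) \<longlonglongrightarrow> f \<omega>"
    proof (cases "f \<omega> = 0")
      \<comment> \<open>Where the limit is 0 the cut-off admits only the value 0; elsewhere the
        norms of the \<open>s i\<close> eventually fall below twice that of the limit, and nothing
        is cut off.\<close>
      case True
      then have "s' i \<omega> = 0" for i by (simp add: s'_def)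
      then show ?thesis using True by simp
    next
      case False
      have "(\<lambda>i. norm (s i \<omega>)) \<longlonglongrightarrow> norm (f \<omega>)"
        using elim by (rule tendsto_norm)
      then have "\<forall>\<^sub>F i in sequentially. norm (s i \<omega>) < 2 * norm (f \<omega>)"
        using False by (intro order_tendstoD) auto
      then have "\<forall>\<^sub>F i in sequentially. s i \<omega> = s' i \<omega>"
        by eventually_elim (simp add: s'_def)
      then show ?thesis
        using elim by (rule Lim_transform_eventually[rotated])
    qed
    then have "(\<lambda>i. norm (f \<omega> - s' i \<omega>)) \<longlonglongrightarrow> 0"
      by (auto intro!: tendsto_eq_intros)
    then show ?case
      using tendsto_ennrealI by fastforce
  qed
  have "(\<lambda>i. \<integral>\<^sup>+\<omega>. norm (f \<omega> - s' i \<omega>) \<partial>M) \<longlonglongrightarrow> (\<integral>\<^sup>+\<omega>. 0 \<partial>M)"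
  \<comment> \<open>The 3 is 1 for \<open>f\<close> itself plus 2 from the cut-off.\<close>
  proof (rule nn_integral_dominated_convergence[where w = "\<lambda>\<omega>. ennreal (3 * norm (f \<omega>))"])
    show "AE \<omega> in M. ennreal (norm (f \<omega> - s' i \<omega>)) \<le> ennreal (3 * norm (f \<omega>))" for i
    proof (intro AE_I2 ennreal_leI)
      fix \<omega>
      have "norm (f \<omega> - s' i \<omega>) \<le> norm (f \<omega>) + norm (s' i \<omega>)"
        by (rule norm_triangle_ineq4)
      also have "norm (s' i \<omega>) \<le> 2 * norm (f \<omega>)"
        by (simp add: s'_def)
      finally show "norm (f \<omega> - s' i \<omega>) \<le> 3 * norm (f \<omega>)" by simp
    qed
    show "(\<integral>\<^sup>+\<omega>. ennreal (3 * norm (f \<omega>)) \<partial>M) < \<infinity>"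
      using int by (simp add: integrable_iff_bounded ennreal_mult nn_integral_cmult ennreal_mult_less_top)
  qed (use lim' in auto)
  moreover have "Bochner_Integration.simple_bochner_integrable M (s' i)" for i
    using s' by (intro simple_bochner_integrable.intros) auto
  ultimately show ?thesis
    using f unfolding bochner_integrable_def by auto
qed

text \<open>Translation by a constant is continuous, so it keeps Borel measurability even without
  separability. It serves to remove the term \<open>t *\<^sub>R unit_bcontfun\<close> from the
  martingale.\<close>

lemma strongly_measurable_add_const:
  assumes "strongly_measurable M f"
  shows "strongly_measurable M (\<lambda>\<omega>. f \<omega> + c)"
proof -
  obtain s where f: "f \<in> borel_measurable M"
    and s: "\<And>i. simple_function M (s i)" "AE \<omega> in M. (\<lambda>i. s i \<omega>) \<longlonglongrightarrow> f \<omega>"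
    using assms unfolding strongly_measurable_def by blast
  have "(\<lambda>\<omega>. f \<omega> + c) \<in> borel_measurable M"
    by (rule measurable_compose[OF f]) (intro borel_measurable_continuous_onI continuous_intros)
  moreover have "simple_function M (\<lambda>\<omega>. s i \<omega> + c)" for i
    using simple_function_compose1[OF s(1), of "\<lambda>x. x + c"] .
  moreover have "AE \<omega> in M. (\<lambda>i. s i \<omega> + c) \<longlonglongrightarrow> f \<omega> + c"
    using s(2) by eventually_elim (intro tendsto_intros)
  ultimately show ?thesis
    unfolding strongly_measurable_def by (intro conjI exI[of _ "\<lambda>i \<omega>. s i \<omega> + c"]) auto
qed

lemma (in finite_measure) bochner_integrable_add_const:
  assumes "bochner_integrable M f"
  shows "bochner_integrable M (\<lambda>\<omega>. f \<omega> + c)"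
proof (rule bochner_integrableI_norm)
  show f: "strongly_measurable M (\<lambda>\<omega>. f \<omega> + c)"
    using assms by (intro strongly_measurable_add_const) (simp add: bochner_integrable_def)
  have "integrable M (\<lambda>\<omega>. norm (f \<omega>) + norm c)"
    using bochner_integrable_integrable_norm[OF assms] by simp
  then show "integrable M (\<lambda>\<omega>. norm (f \<omega> + c))"
    by (rule Bochner_Integration.integrable_bound)
       (auto intro: strongly_measurable_norm[OF f] norm_triangle_ineq)
qed

section \<open>Order, product and norm in C(K)\<close>

lemma f_algebra_bcontfun:
  "f_algebra (UNIV :: ('k::topological_space \<Rightarrow>\<^sub>C real) set)
     le_bcontfun inf_bcontfun sup_bcontfun mult_bcontfun"
proof -
  have eq: "x = y \<longleftrightarrow> (\<forall>k. apply_bcontfun x k = apply_bcontfun y k)" for x y :: "'k \<Rightarrow>\<^sub>C real"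
    using bcontfun_eqI by blast
  \<comment> \<open>This is the disjointness axiom at a single point: one of \<open>a\<close>,
    \<open>b\<close> is 0 and the other nonnegative. All operations being pointwise, every axiom
    reduces to real numbers, and the whole of C(K) can serve as the f-algebra.\<close>
  have wedge: "min (a * c) b = 0 \<and> min (c * a) b = 0" if "min a b = 0" "0 \<le> c" for a b c :: real
  proof -
    have "a = 0 \<and> 0 \<le> b \<or> b = 0 \<and> 0 \<le> a"
      using that(1) by (auto simp: min_def split: if_splits)
    then show ?thesis
      using that(2) mult_nonneg_nonneg[of a c] by (auto simp: mult.commute)
  qed
  show ?thesis
    unfolding f_algebra_def riesz_space_def
    by (auto simp: eq le_bcontfun_def bcontfun_binop algebra_simps wedge
        intro: order_trans order.antisym mult_left_mono)
qed

lemma mult_bcontfun_self_norm: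
  "norm (mult_bcontfun x x) = (norm x)\<^sup>2" for x :: "'k::topological_space \<Rightarrow>\<^sub>C real"
proof (rule antisym)
  have "norm (apply_bcontfun x k * x k) \<le> (norm x)\<^sup>2" for k
    using norm_bounded[of x k] by (simp add: power2_eq_square mult_mono norm_mult del: real_norm_def)
  then show "norm (mult_bcontfun x x) \<le> (norm x)\<^sup>2"
    by (intro norm_bound) (simp add: mult_bcontfun_apply)
  \<comment> \<open>Taking the root pointwise allows passing to the supremum of \<open>x\<close>
    before squaring back.\<close>
  have "norm (x k) \<le> sqrt (norm (mult_bcontfun x x))" for k
    using norm_bounded[of "mult_bcontfun x x" k]
    by (intro real_le_rsqrt) (simp add: mult_bcontfun_apply power2_eq_square)
  then have "norm x \<le> sqrt (norm (mult_bcontfun x x))"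
    by (rule norm_bound)
  then have "(norm x)\<^sup>2 \<le> (sqrt (norm (mult_bcontfun x x)))\<^sup>2"
    by (rule power_mono) simp
  then show "(norm x)\<^sup>2 \<le> norm (mult_bcontfun x x)" by simp
qed

section \<open>Expectations along a martingale\<close>

lemma (in finite_measure) bochner_cond_exp_integral_eq:
  fixes \<phi> :: "'b::real_normed_vector \<Rightarrow> real"
  assumes F: "subalgebra M F" and W: "bochner_integrable M W" and V: "bochner_cond_exp M F W V"
    and \<phi>: "bounded_linear \<phi>" and [measurable]: "(\<lambda>\<omega>. \<phi> (V \<omega>)) \<in> borel_measurable M"
  shows "(\<integral>\<omega>. \<phi> (V \<omega>) \<partial>M) = (\<integral>\<omega>. \<phi> (W \<omega>) \<partial>M)"
proof -
  interpret F: finite_measure_subalgebra M F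
    using F by unfold_locales
  have "AE \<omega> in M. real_cond_exp M F (\<lambda>\<omega>'. \<phi> (W \<omega>')) \<omega> = \<phi> (V \<omega>)"
    using V \<phi> by (simp add: bochner_cond_exp_def)
  then have "(\<integral>\<omega>. \<phi> (V \<omega>) \<partial>M) = (\<integral>\<omega>. real_cond_exp M F (\<lambda>\<omega>'. \<phi> (W \<omega>')) \<omega> \<partial>M)"
    by (intro integral_cong_AE) auto
  also have "\<dots> = (\<integral>\<omega>. \<phi> (W \<omega>) \<partial>M)"
    by (intro F.real_cond_exp_int bochner_integrable_bounded_linear[OF W \<phi>])
  finally show ?thesis .
qed

lemma subalgebra_natural_filtration:
  assumes "\<And>u. 0 \<le> u \<Longrightarrow> Y u \<in> borel_measurable M"
  shows "subalgebra M (natural_filtration M Y s)"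
proof -
  let ?G = "{Y u -` A \<inter> space M | u A. 0 \<le> u \<and> u \<le> s \<and> A \<in> sets borel}"
  have G: "?G \<subseteq> sets M"
    using assms by (auto intro: measurable_sets)
  then have "?G \<subseteq> Pow (space M)"
    using sets.space_closed by blast
  then show ?thesis
    using sets.sigma_sets_subset[OF G]
    by (simp add: subalgebra_def natural_filtration_def space_measure_of_conv)
qed

text \<open>This is how the conditional expectations enter the argument: \<open>\<phi>\<close>
  commutes with them by definition, and they preserve integrals.\<close>

lemma (in finite_measure) pointwise_martingale_integral_eq:
  fixes \<phi> :: "'b::real_normed_vector \<Rightarrow> real"
  assumes Y: "pointwise_martingale M Y" and \<phi>: "bounded_linear \<phi>" and st: "0 \<le> s" "s \<le> t"
  shows "(\<integral>\<omega>. \<phi> (Y t \<omega>) \<partial>M) = (\<integral>\<omega>. \<phi> (Y s \<omega>) \<partial>M)"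
proof (cases "s = t")
  case False
  with st have "s < t" by simp
  have int: "bochner_integrable M (Y u)" if "0 \<le> u" for u
    using Y that by (simp add: pointwise_martingale_def)
  have "subalgebra M (natural_filtration M Y s)"
    using int by (intro subalgebra_natural_filtration) (simp add: bochner_integrable_def strongly_measurable_def)
  moreover have "bochner_cond_exp M (natural_filtration M Y s) (Y t) (Y s)"
    using Y st \<open>s < t\<close> by (simp add: pointwise_martingale_def)
  moreover have "integrable M (\<lambda>\<omega>. \<phi> (Y s \<omega>))"
    using int st \<phi> by (intro bochner_integrable_bounded_linear) auto
  ultimately show ?thesis
    using bochner_cond_exp_integral_eq[OF _ int[of t] _ \<phi>] st by auto
qed simp

lemma bounded_linear_apply_bcontfun:
  "bounded_linear (\<lambda>x :: 'k::topological_space \<Rightarrow>\<^sub>C real. apply_bcontfun x k)"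
  using norm_bounded[of _ k, where 'b = real] by (intro bounded_linear_intro[where K = 1]) auto

theorem theorem3p10:
  fixes j :: "'x::banach set \<Rightarrow> ('k::t2_space \<Rightarrow>\<^sub>C real)"
    and M :: "'w measure"
    and B :: "real \<Rightarrow> 'w \<Rightarrow> ('k \<Rightarrow>\<^sub>C real)"
  assumes "compact (UNIV :: 'k set)"
    and "ck_embedding j"
    and "prob_space M"
    and "weak_gaussian_process j M B"
    and "homogeneous_increments M B"
    and "AE \<omega> in M. B 0 \<omega> = 0"
    and "pointwise_martingale M
           (\<lambda>t \<omega>. mult_bcontfun (B t \<omega>) (B t \<omega>) - t *\<^sub>R unit_bcontfun)"
  shows "weak_wiener_process j M B \<and>
         (weakly_continuous_trajectories M B \<longrightarrow> set_valued_brownian_motion j M B)"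
proof -
  interpret prob_space M by fact
  let ?W = "\<lambda>t \<omega>. mult_bcontfun (B t \<omega>) (B t \<omega>) - t *\<^sub>R unit_bcontfun"
  have sv: "set_valued_process j M B"
    and gauss: "\<And>k. gaussian_process M (\<lambda>t \<omega>. B t \<omega> k)"
    using assms(4) by (auto simp: weak_gaussian_process_def evaluation_functional_def)
  have Bt: "strongly_measurable M (B t)" if "0 \<le> t" for t
    using sv that by (simp add: set_valued_process_def)
  have Y: "(\<lambda>\<omega>. B t \<omega> k) \<in> borel_measurable M" if "0 \<le> t" for t k
    using gauss[of k, unfolded gaussian_process_def, rule_format, of "{t}" "\<lambda>_. 1"] that
    by (simp add: gaussian_rv_def)
  have W: "bochner_integrable M (?W t)" if "0 \<le> t" for t
    using assms(7) that by (simp add: pointwise_martingale_def)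
  have sq_bochner: "bochner_integrable M (\<lambda>\<omega>. mult_bcontfun (B t \<omega>) (B t \<omega>))" if "0 \<le> t" for t
    using bochner_integrable_add_const[OF W[OF that], of "t *\<^sub>R unit_bcontfun"] by simp
  \<comment> \<open>Gaussian evaluations do not control the supremum norm. The norm is square
    integrable because the squared process is Bochner integrable, hence integrable as the measure is
    finite.\<close>
  have B_bochner: "bochner_integrable M (B t)" if "0 \<le> t" for t
  proof (rule bochner_integrableI_norm[OF Bt[OF that]])
    have "integrable M (\<lambda>\<omega>. (norm (B t \<omega>))\<^sup>2)"
      using bochner_integrable_integrable_norm[OF sq_bochner[OF that]] by (simp add: mult_bcontfun_self_norm)
    then show "integrable M (\<lambda>\<omega>. norm (B t \<omega>))"
      by (rule square_integrable_imp_integrable[OF strongly_measurable_norm[OF Bt[OF that]]])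
  qed
  have sq: "integrable M (\<lambda>\<omega>. (B t \<omega> k)\<^sup>2)" if "0 \<le> t" for t k
    using bochner_integrable_bounded_linear[OF sq_bochner[OF that] bounded_linear_apply_bcontfun[of k]]
    by (simp add: mult_bcontfun_apply power2_eq_square)
  have start: "AE \<omega> in M. B 0 \<omega> k = 0" for k
    using assms(6) by eventually_elim simp
  have second: "expectation (\<lambda>\<omega>. (B t \<omega> k)\<^sup>2) = t" if "0 \<le> t" for t k
  proof -
    have "expectation (\<lambda>\<omega>. (B t \<omega> k)\<^sup>2) - t = expectation (\<lambda>\<omega>. ?W t \<omega> k)"
      using sq[OF that, of k] by (simp add: mult_bcontfun_apply power2_eq_square prob_space)
    \<comment> \<open>Time 0 is the reference point: there both the square and the correction
      \<open>t *\<^sub>R unit_bcontfun\<close> vanish almost everywhere.\<close>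
    also have "\<dots> = expectation (\<lambda>\<omega>. ?W 0 \<omega> k)"
      using pointwise_martingale_integral_eq[OF assms(7) bounded_linear_apply_bcontfun order_refl that] .
    also have "\<dots> = 0"
    proof (rule integral_eq_zero_AE)
      show "AE \<omega> in M. ?W 0 \<omega> k = 0"
        using start[of k] by eventually_elim (simp add: mult_bcontfun_apply)
    qed
    finally show ?thesis by simp
  qed
  have hom: "distr M borel (\<lambda>\<omega>. B t \<omega> k - B s \<omega> k) = distr M borel (\<lambda>\<omega>. B (t - s) \<omega> k)"
    if "0 \<le> s" "s < t" for s t k
  proof -
    have "evaluation_functional (\<lambda>x :: 'k \<Rightarrow>\<^sub>C real. x k)"
      by (auto simp: evaluation_functional_def)
    then have "distr M borel (\<lambda>\<omega>. (B t \<omega> - B s \<omega>) k) = distr M borel (\<lambda>\<omega>. B (t - s) \<omega> k)"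
      using assms(5) that unfolding homogeneous_increments_def by blast
    then show ?thesis by simp
  qed
  have mean: "expectation (\<lambda>\<omega>. B t \<omega> k) = 0" if "0 \<le> t" for t k
    using that by (intro expectation_zero_if_homogeneous[where Y = "\<lambda>t \<omega>. B t \<omega> k"] Y sq second hom)
  have int: "integrable M (\<lambda>\<omega>. B s \<omega> k * B t \<omega> k)"
    and cov: "expectation (\<lambda>\<omega>. B s \<omega> k * B t \<omega> k) = min s t" if "0 \<le> s" "0 \<le> t" for s t k
    using that by (intro integrable_product_if_homogeneous[where Y = "\<lambda>t \<omega>. B t \<omega> k"] Y sq second hom; simp)+
  have "weak_wiener_process j M B"
    using sv gauss mean start int cov
    by (auto simp: weak_wiener_process_def evaluation_functional_def mult_bcontfun_apply min.commute)
  moreover have "set_valued_brownian_motion j M B" if cont: "weakly_continuous_trajectories M B"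
  proof -
    have "standard_brownian_motion M (\<lambda>t \<omega>. B t \<omega> k)" for k
    proof (intro standard_brownian_motion_if_gaussian gauss mean int cov start)
      \<comment> \<open>Evaluation at \<open>k\<close> is a bounded functional, so weak continuity
        applies to it.\<close>
      show "continuous_on {0..} (\<lambda>t. B t \<omega> k)" if "\<omega> \<in> space M" for \<omega>
        using cont that bounded_linear_apply_bcontfun[of k]
        unfolding weakly_continuous_trajectories_def by blast
    qed
    then show ?thesis
      unfolding set_valued_brownian_motion_def
      using sv f_algebra_bcontfun B_bochner sq_bochner
      by (auto simp: evaluation_functional_def intro!: exI[of _ UNIV])
  qed
  ultimately show ?thesis by blast
qed

end
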